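(* (i) (Non-overlapping case.) For $\ell=1,2$ let $(\mathcal{S}_\ell,\boldsymbol{d}_{\mathcal{S}_\ell})$ be a proper Polish metric space, $p_\ell\ge1$, $\mu_\ell\in\mathcal{P}_{p_\ell}(\mathcal{S}_\ell)$ and $c_\ell=\boldsymbol{d}_{\mathcal{S}_\ell}^{p_\ell}$. Let $g:\mathcal{S}_1\times\mathcal{S}_2\to\mathbb{R}$ be continuous and suppose there exist $M>0$, $(s_1^\star,s_2^\star)\in\mathcal{S}_1\times\mathcal{S}_2$ and $p_\ell'\in(0,p_\ell)$, $\ell=1,2$, such that $|g(s_1,s_2)|\le M[1+\boldsymbol{d}_{\mathcal{S}_1}(s_1^\star,s_1)^{p_1'}+\boldsymbol{d}_{\mathcal{S}_2}(s_2^\star,s_2)^{p_2'}]$ for all $(s_1,s_2)\in\mathcal{S}_1\times\mathcal{S}_2$. Then, for $\delta\in\mathbb{R}_+^2$, the set $\Theta_{\mathrm{D}}(\delta)=\left\{\int_{\mathcal{S}_1\times\mathcal{S}_2} g\,d\gamma:\gamma\in\Sigma_{\mathrm{D}}(\delta)\right\}$ satisfies $$\Theta_{\mathrm{D}}(\delta)=\left[\min_{\gamma\in\Sigma_{\mathrm{D}}(\delta)}\int_{\mathcal{S}_1\times\mathcal{S}_2} g\,d\gamma,\ \max_{\gamma\in\Sigma_{\mathrm{D}}(\delta)}\int_{\mathcal{S}_1\times\mathcal{S}_2} g\,d\gamma\right],$$ where both the lower and upper bounds are finite. (ii) (Overlapping case.) Let $\mathcal{Y}_1,\mathcal{Y}_2,\mathcal{X}$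 be Polish spaces, $\mathcal{S}=\mathcal{Y}_1\times\mathcal{Y}_2\times\mathcal{X}$, $\mathcal{S}_\ell=\mathcal{Y}_\ell\times\mathcal{X}$; let $\boldsymbol{d}_{\mathcal{S}_\ell}$ be a metric making $\mathcal{S}_\ell$ (with its product topology) a proper Polish metric space, $p_\ell\ge1$, $c_\ell=\boldsymbol{d}_{\mathcal{S}_\ell}^{p_\ell}$, and $\mu_{\ell3}\in\mathcal{P}_{p_\ell}(\mathcal{S}_\ell)$ for $\ell=1,2$, with $\mu_{13}$ and $\mu_{23}$ having the same projection on $\mathcal{X}$. Let $f:\mathcal{S}\to\mathbb{R}$ be continuous and suppose there exist $M>0$, $(s_1^\star,s_2^\star)\in\mathcal{S}_1\times\mathcal{S}_2$ and $p_\ell'\in(0,p_\ell)$, $\ell=1,2$, such that $|f(s)|\le M[1+\boldsymbol{d}_{\mathcal{S}_1}(s_1^\star,s_1)^{p_1'}+\boldsymbol{d}_{\mathcal{S}_2}(s_2^\star,s_2)^{p_2'}]$ for all $s=(y_1,y_2,x)\in\mathcal{S}$, where $s_\ell=(y_\ell,x)$. Then, for $\delta\in\mathbb{R}_+^2$, the set $\Theta(\delta)=\left\{\int_{\mathcal{S}} f\,d\gamma:\gamma\in\Sigma(\delta)\right\}$ satisfies $$\Theta(\delta)=\left[\min_{\gamma\in\Sigma(\delta)}\int_{\mathcal{S}} f\,d\gamma,\ \max_{\gamma\in\Sigma(\delta)}\int_{\mathcal{S}} f\,d\gamma\right],$$ where both the lower and upper bounds are finite.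
   Context: A metric space is proper if all its closed balls are compact. $\mathcal{P}(\cdot)$ is the set of Borel probability measures; $\mathcal{P}_p(\mathcal{X})$ is the set of $\mu\in\mathcal{P}(\mathcal{X})$ with $\int\boldsymbol{d}(x_0,x)^p\,d\mu(x)<\infty$ for some (any) $x_0$; $\Pi(\mu,\nu)$ is the set of couplings; $\mathbb{R}_+^2$ is the set of vectors with nonnegative coordinates. $\boldsymbol{K}_\ell(\mu,\nu)=\inf_{\pi\in\Pi(\mu,\nu)}\int c_\ell\,d\pi$. Non-overlapping: $\Sigma_{\mathrm{D}}(\delta)=\{\gamma\in\mathcal{P}(\mathcal{S}_1\times\mathcal{S}_2):\boldsymbol{K}_1(\mu_1,\gamma_1)\le\delta_1,\ \boldsymbol{K}_2(\mu_2,\gamma_2)\le\delta_2\}$, with $\gamma_\ell$ the projection of $\gamma$ on $\mathcal{S}_\ell$. Overlapping: $\Sigma(\delta)=\{\gamma\in\mathcal{P}(\mathcal{S}):\boldsymbol{K}_1(\mu_{13},\gamma_{13})\le\delta_1,\ \boldsymbol{K}_2(\mu_{23},\gamma_{23})\le\delta_2\}$, with $\gamma_{\ell3}$ the projection of $\gamma$ on $\mathcal{Y}_\ell\times\mathcal{X}$. *)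

theory Defs
  imports "HOL-Probability.Probability"
begin

abbreviation borel_probs :: "'a::topological_space measure set" where
  "borel_probs \<equiv> space (prob_algebra borel)"

definition proper_metric :: "('a::topological_space \<Rightarrow> 'a \<Rightarrow> real) \<Rightarrow> bool" where
  "proper_metric d \<longleftrightarrow> (\<forall>x r. compact {y. d x y \<le> r})"

text \<open>
  A metric on the whole type that induces the topology the type already has (rather than the
  type class metric) and makes it a Polish metric space. It is needed for product types, whose
  type class metric is the Euclidean combination of the metrics of the factors, whereas
  here the metric on a product is arbitrary.
\<close>
definition polish_metric :: "('a::topological_space \<Rightarrow> 'a \<Rightarrow> real) \<Rightarrow> bool" where
  "polish_metric d \<longleftrightarrow>
     Metric_space UNIV d \<and>
     Metric_space.mtopology UNIV d = euclidean \<and>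
     Metric_space.mcomplete UNIV d \<and>
     separable_space (Metric_space.mtopology UNIV d)"

definition finite_moment_probs ::
  "('a::topological_space \<Rightarrow> 'a \<Rightarrow> real) \<Rightarrow> real \<Rightarrow> 'a measure set" where
  "finite_moment_probs d p =
     {\<mu> \<in> borel_probs. \<exists>x0. (\<integral>\<^sup>+ x. ennreal (d x0 x powr p) \<partial>\<mu>) < \<infinity>}"

definition couplings ::
  "'a::topological_space measure \<Rightarrow> 'b::topological_space measure \<Rightarrow> ('a \<times> 'b) measure set" where
  "couplings \<mu> \<nu> =
     {\<pi> \<in> borel_probs. distr \<pi> borel fst = \<mu> \<and> distr \<pi> borel snd = \<nu>}"

text \<open>Meant for nonnegative costs: \<open>ennreal\<close> truncates negative values to 0.\<close>
definition transport_cost ::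
  "('a::topological_space \<Rightarrow> 'a \<Rightarrow> real) \<Rightarrow> 'a measure \<Rightarrow> 'a measure \<Rightarrow> ennreal" where
  "transport_cost c \<mu> \<nu> =
     (INF \<pi> \<in> couplings \<mu> \<nu>. \<integral>\<^sup>+ z. ennreal (c (fst z) (snd z)) \<partial>\<pi>)"

text \<open>
  The marginals prescribed by the reference measures live on separate factors in \<open>Sigma_D\<close>, and
  overlap in the last coordinate \<open>'x\<close> in \<open>Sigma_O\<close>.
\<close>
definition Sigma_D ::
  "('a::topological_space \<Rightarrow> 'a \<Rightarrow> real) \<Rightarrow> ('b::topological_space \<Rightarrow> 'b \<Rightarrow> real) \<Rightarrow>
   'a measure \<Rightarrow> 'b measure \<Rightarrow> real \<Rightarrow> real \<Rightarrow> ('a \<times> 'b) measure set" where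
  "Sigma_D c1 c2 \<mu>1 \<mu>2 \<delta>1 \<delta>2 =
     {\<gamma> \<in> borel_probs.
        transport_cost c1 \<mu>1 (distr \<gamma> borel fst) \<le> ennreal \<delta>1 \<and>
        transport_cost c2 \<mu>2 (distr \<gamma> borel snd) \<le> ennreal \<delta>2}"

definition Sigma_O ::
  "('y1::topological_space \<times> 'x::topological_space \<Rightarrow> 'y1 \<times> 'x \<Rightarrow> real) \<Rightarrow>
   ('y2::topological_space \<times> 'x \<Rightarrow> 'y2 \<times> 'x \<Rightarrow> real) \<Rightarrow>
   ('y1 \<times> 'x) measure \<Rightarrow> ('y2 \<times> 'x) measure \<Rightarrow> real \<Rightarrow> real \<Rightarrow>
   ('y1 \<times> 'y2 \<times> 'x) measure set" where
  "Sigma_O c1 c2 \<mu>13 \<mu>23 \<delta>1 \<delta>2 =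
     {\<gamma> \<in> borel_probs.
        transport_cost c1 \<mu>13 (distr \<gamma> borel (\<lambda>(y1, y2, x). (y1, x))) \<le> ennreal \<delta>1 \<and>
        transport_cost c2 \<mu>23 (distr \<gamma> borel (\<lambda>(y1, y2, x). (y2, x))) \<le> ennreal \<delta>2}"

text \<open>
  The Bochner integral of a non-integrable function is 0, so this is the intended set only when
  \<open>h\<close> is integrable for every measure in \<open>S\<close>.
\<close>
definition integral_values :: "('s \<Rightarrow> real) \<Rightarrow> 's measure set \<Rightarrow> real set" where
  "integral_values h S = {\<integral>s. h s \<partial>\<gamma> | \<gamma>. \<gamma> \<in> S}"

end

theory Submission
  imports Defs
begin

(*
  Both parts are instances of one statement about continuous maps q1, q2 into spaces with proper
  metrics d1, d2: the set of laws whose images under q1, q2 lie in closed transport balls is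
  convex, and it is sequentially compact for weak convergence. Indeed the bound on the transport
  cost bounds the moment of V = d1^p1 + d2^p2, whose sublevel sets are compact, so Prokhorov's
  theorem applies; the balls are closed because almost optimal couplings are again tight and the cost is
  lower semicontinuous. As the integrand grows more slowly than V, its integral is continuous
  along convergent sequences, so its values form a compact convex subset of the line. The only
  difference between the two parts is nonemptiness: a product measure in the first, a gluing of
  the two reference measures along their common marginal in the second.

  Weakly convergent sequences are always represented as laws of almost surely convergent random
  variables, so that only dominated convergence and Fatou's lemma are needed.
*)

text \<open>The tightness criterion and the Skorokhod representation are applied to laws on the real
  line, and this shapes the construction. A space with a continuous \<open>V\<close> having compact
  sublevel sets is coded into the reals by a Borel map \<open>s\<close>. The coding is not
  continuous, but convergence of codes forces convergence of points, so the decoding extends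
  continuously to the closure of the codes, where limits of codes lie. Since the code stays within 2
  of \<open>V\<close>, a bound on the \<open>V\<close>-moments is tightness of the coded laws. Every
  representation produces a new probability space, so limits obtained from different representations
  have to be compared through their laws alone. The strict inequalities p1' < p1 and p2' < p2 enter
  as follows: for every e > 0 the integrand is bounded by R + e V with some constant R. Truncating
  it at height R therefore costs at most e times the moment bound, uniformly over the whole set of
  measures.\<close>

section \<open>Coding a space into the real line and decoding limits\<close>

text \<open>Two such sums with different integer parts are at least 2/3 apart, so a Cauchy sequence
  cannot keep switching integer parts. The bound 1/3 is the largest base-4 fraction with digits 0
  and 1.\<close>

lemma convergent_int_plus_frac:
  fixes a :: "nat \<Rightarrow> int" and b :: "nat \<Rightarrow> real"
  assumes b: "\<And>n. 0 \<le> b n" "\<And>n. b n \<le> 1/3"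
    and conv: "convergent (\<lambda>n. of_int (a n) + b n)"
  shows "\<exists>c. eventually (\<lambda>n. a n = c) sequentially" and "convergent b"
proof -
  have "Cauchy (\<lambda>n. of_int (a n) + b n)"
    using conv by (simp add: Cauchy_convergent_iff)
  from metric_CauchyD[OF this, of "1/3"]
  obtain N where N: "\<And>m n. m \<ge> N \<Longrightarrow> n \<ge> N \<Longrightarrow> dist (of_int (a m) + b m) (of_int (a n) + b n) < 1/3"
    by auto
  have eq: "a n = a N" if "n \<ge> N" for n
  proof -
    have "\<bar>(of_int (a n) + b n) - (of_int (a N) + b N)\<bar> < 1/3"
      using N[OF that order.refl] by (simp add: dist_real_def)
    with b[of n] b[of N] have "\<bar>real_of_int (a n) - of_int (a N)\<bar> < 1" by arith
    thus ?thesis by linarith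
  qed
  show ev: "\<exists>c. eventually (\<lambda>n. a n = c) sequentially"
    unfolding eventually_sequentially using eq by blast
  obtain L where L: "(\<lambda>n. of_int (a n) + b n) \<longlonglongrightarrow> L" using conv by (auto simp: convergent_def)
  have "(\<lambda>n. (of_int (a n) + b n) - of_int (a N)) \<longlonglongrightarrow> L - of_int (a N)"
    by (intro tendsto_intros L)
  moreover have "eventually (\<lambda>n. (of_int (a n) + b n) - of_int (a N) = b n) sequentially"
    unfolding eventually_sequentially using eq by (intro exI[of _ N]) (metis add_diff_cancel_left')
  ultimately have "b \<longlonglongrightarrow> L - of_int (a N)"
    by (rule Lim_transform_eventually)
  thus "convergent b" by (auto simp: convergent_def)
qed

text \<open>Comparison with the geometric series of ratio 1/4 gives 1/3, and the distance of 1/3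
  from 1 is the gap that separates codes. The last identity shifts the expansion by one place: the
  leading digit becomes the integer part and the rest is again a fraction of the same kind.\<close>

lemma base4_series:
  fixes d :: "nat \<Rightarrow> real"
  assumes "\<And>i. 0 \<le> d i" "\<And>i. d i \<le> 1"
  shows "summable (\<lambda>i. d i / 4 ^ Suc i)" and "0 \<le> (\<Sum>i. d i / 4 ^ Suc i)"
    and "(\<Sum>i. d i / 4 ^ Suc i) \<le> 1/3"
    and "4 * (\<Sum>i. d i / 4 ^ Suc i) = d 0 + (\<Sum>i. d (Suc i) / 4 ^ Suc i)"
proof -
  have g: "(\<lambda>i. (1/4) * (1/4::real) ^ i) sums ((1/4) * (1 / (1 - 1/4)))"
    by (intro sums_mult geometric_sums) simp
  have le: "d i / 4 ^ Suc i \<le> (1/4) * (1/4) ^ i" for i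
    using assms(2)[of i] by (simp add: field_simps power_divide)
  show s: "summable (\<lambda>i. d i / 4 ^ Suc i)"
    by (rule summable_comparison_test[OF _ sums_summable[OF g]])
       (use assms(1) le in \<open>auto intro!: exI[of _ 0]\<close>)
  show "0 \<le> (\<Sum>i. d i / 4 ^ Suc i)"
    by (rule suminf_nonneg[OF s]) (simp add: assms)
  have "(\<Sum>i. d i / 4 ^ Suc i) \<le> (\<Sum>i. (1/4) * (1/4::real) ^ i)"
    by (rule suminf_le[OF le s sums_summable[OF g]])
  also have "\<dots> = 1/3" using sums_unique[OF g] by simp
  finally show "(\<Sum>i. d i / 4 ^ Suc i) \<le> 1/3" .
  have s': "summable (\<lambda>i. d (Suc i) / 4 ^ Suc (Suc i))"
    using s by (subst (asm) summable_Suc_iff[symmetric])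
  have "(\<Sum>i. d i / 4 ^ Suc i) = d 0 / 4 + (\<Sum>i. d (Suc i) / 4 ^ Suc (Suc i))"
    using suminf_split_head[OF s] by simp
  also have "(\<Sum>i. d (Suc i) / 4 ^ Suc (Suc i)) = (\<Sum>i. (d (Suc i) / 4 ^ Suc i) / 4)"
    by (simp add: field_simps)
  also have "\<dots> = (\<Sum>i. (d (Suc i) / 4 ^ Suc i)) / 4"
  proof (rule suminf_divide)
    have "summable (\<lambda>i. 4 * (d (Suc i) / 4 ^ Suc (Suc i)))" using s' by (rule summable_mult)
    thus "summable (\<lambda>i. d (Suc i) / 4 ^ Suc i)" by simp
  qed
  finally show "4 * (\<Sum>i. d i / 4 ^ Suc i) = d 0 + (\<Sum>i. d (Suc i) / 4 ^ Suc i)" by simp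
qed

text \<open>Compactness supplies a cluster point. Each basic neighbourhood of it is visited
  infinitely often, and as membership is eventually constant, it is eventually true; hence the whole
  sequence converges there.\<close>

lemma convergent_in_compact_if_base_eventually_const:
  fixes x :: "nat \<Rightarrow> 'a::metric_space" and B :: "nat \<Rightarrow> 'a set"
  assumes K: "compact K" "eventually (\<lambda>n. x n \<in> K) sequentially"
    and base: "topological_basis (range B)"
    and const: "\<And>i. \<exists>c. eventually (\<lambda>n. (x n \<in> B i) = c) sequentially"
  shows "convergent x"
proof -
  obtain N where N: "\<And>n. n \<ge> N \<Longrightarrow> x n \<in> K" using K(2) by (auto simp: eventually_sequentially)
  define y where "y n = x (n + N)" for n
  have y: "\<forall>n. y n \<in> K" using N by (simp add: y_def)
  obtain l r where l: "l \<in> K" "strict_mono r" "(y \<circ> r) \<longlonglongrightarrow> l"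
    using K(1) y unfolding compact_eq_seq_compact_metric seq_compact_def by metis
  have "x \<longlonglongrightarrow> l"
  proof (rule topological_tendstoI)
    fix S assume S: "open S" "l \<in> S"
    obtain i where i: "l \<in> B i" "B i \<subseteq> S"
      using topological_basisE[OF base S] by (metis rangeE)
    have "open (B i)" using base by (auto simp: topological_basis_open)
    hence ev: "eventually (\<lambda>n. (y \<circ> r) n \<in> B i) sequentially"
      using topological_tendstoD[OF l(3) _ i(1)] by blast
    obtain c where c: "eventually (\<lambda>n. (x n \<in> B i) = c) sequentially" using const by blast
    have "filterlim (\<lambda>n. r n + N) sequentially sequentially"
      by (rule filterlim_subseq) (use l(2) in \<open>auto simp: strict_mono_def\<close>)
    hence "eventually (\<lambda>n. (x (r n + N) \<in> B i) = c) sequentially"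
      using c by (rule eventually_compose_filterlim[rotated])
    with ev have "eventually (\<lambda>n. c) sequentially"
      by eventually_elim (simp add: y_def)
    hence "c" by simp
    with c i(2) show "eventually (\<lambda>n. x n \<in> S) sequentially"
      by (auto elim!: eventually_mono)
  qed
  thus ?thesis by (auto simp: convergent_def)
qed

text \<open>The coding adds to the rounded-up \<open>V\<close> a base-4 fraction whose digits tell which basic open
  sets contain the point; digits 0 and 1 in base 4 leave gaps, so convergence of the codes
  stabilises every digit.\<close>

lemma real_coding:
  fixes V :: "'a::{second_countable_topology,metric_space} \<Rightarrow> real"
  assumes V: "continuous_on UNIV V" "\<And>r. compact {x. V x \<le> r}"
  obtains s :: "'a \<Rightarrow> real" where "s \<in> borel_measurable borel"
    and "\<And>x. \<bar>s x - V x\<bar> \<le> 2"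
    and "\<And>x. convergent (\<lambda>n. s (x n)) \<Longrightarrow> convergent x"
proof -
  obtain \<B> :: "'a set set" where \<B>: "countable \<B>" "topological_basis \<B>"
    using ex_countable_basis by auto
  have "\<B> \<noteq> {}" using topological_basisE[OF \<B>(2) open_UNIV] by blast
  \<comment> \<open>\<open>from_nat_into\<close> enumerates all of the nonempty \<open>\<B>\<close>,
    with repetitions if it is finite, so that the digits can be indexed by all natural
    numbers.\<close>
  define B where "B = from_nat_into \<B>"
  have rB: "range B = \<B>" unfolding B_def using \<B>(1) \<open>\<B> \<noteq> {}\<close> by (rule range_from_nat_into[rotated])
  have oB: "open (B i)" for i using \<B>(2) rB by (metis rangeI topological_basis_open)
  define d where "d x i = (indicator (B i) x :: real)" for x i
  have d01: "0 \<le> d x i" "d x i \<le> 1" for x i by (auto simp: d_def indicator_def)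
  \<comment> \<open>\<open>T k\<close> is the fraction left after the first \<open>k\<close> digits
    have been removed, so that digits can be peeled off one at a time.\<close>
  define T where "T k x = (\<Sum>i. d x (i + k) / 4 ^ Suc i)" for k x
  have T: "0 \<le> T k x" "T k x \<le> 1/3" "4 * T k x = d x k + T (Suc k) x" for k x
    using base4_series(2,3,4)[of "\<lambda>i. d x (i + k)"] d01 by (simp_all add: T_def)
  define s where "s x = of_int \<lceil>V x\<rceil> + T 0 x" for x
  have Vm[measurable]: "V \<in> borel_measurable borel" using V(1) by (rule borel_measurable_continuous_onI)
  have Bm[measurable]: "B i \<in> sets borel" for i using oB by simp
  show ?thesis
  proof (rule that[of s])
    show "s \<in> borel_measurable borel"
      unfolding s_def T_def d_def by measurable
  next
    fix x
    show "\<bar>s x - V x\<bar> \<le> 2" unfolding s_def using T(1,2)[where x=x and k=0] by linarith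
  next
    fix x :: "nat \<Rightarrow> 'a"
    assume conv: "convergent (\<lambda>n. s (x n))"
    note 0 = convergent_int_plus_frac[of "\<lambda>n. T 0 (x n)" "\<lambda>n. \<lceil>V (x n)\<rceil>", OF T(1,2) conv[unfolded s_def]]
    obtain c where c: "eventually (\<lambda>n. \<lceil>V (x n)\<rceil> = c) sequentially" using 0(1) by blast
    have step: "(\<exists>c. eventually (\<lambda>n. (x n \<in> B k) = c) sequentially) \<and> convergent (\<lambda>n. T (Suc k) (x n))"
      if "convergent (\<lambda>n. T k (x n))" for k
    proof -
      have *: "of_int (if x n \<in> B k then 1 else 0) + T (Suc k) (x n) = 4 * T k (x n)" for n
        using T(3)[of k "x n"] by (simp add: d_def)
      have "convergent (\<lambda>n. 4 * T k (x n))"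
        using that by (auto simp: convergent_def intro: tendsto_mult_left)
      hence "convergent (\<lambda>n. of_int (if x n \<in> B k then 1 else 0) + T (Suc k) (x n))"
        by (simp only: *)
      note ** = convergent_int_plus_frac[OF T(1,2) this]
      obtain c :: int where "eventually (\<lambda>n. (if x n \<in> B k then 1 else 0) = c) sequentially"
        using **(1) by blast
      hence "eventually (\<lambda>n. (x n \<in> B k) = (c = 1)) sequentially"
        by eventually_elim (auto split: if_splits)
      with **(2) show ?thesis by blast
    qed
    have all: "convergent (\<lambda>n. T k (x n))" for k
      by (induction k) (use 0(2) step in auto)
    show "convergent x"
    \<comment> \<open>The stabilised value \<open>c\<close> of the rounded-up \<open>V\<close> traps
      the tail of the sequence in one compact sublevel set; the digits settle membership in the
      basic open sets.\<close>
    proof (rule convergent_in_compact_if_base_eventually_const)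
      show "compact {y. V y \<le> of_int c}" by (rule V)
      show "eventually (\<lambda>n. x n \<in> {y. V y \<le> of_int c}) sequentially"
        using c by eventually_elim (auto simp: ceiling_eq_iff)
      show "topological_basis (range B)" using \<B>(2) rB by simp
    qed (use step all in blast)
  qed
qed

lemma borel_probs_iff: "M \<in> borel_probs \<longleftrightarrow> sets M = sets borel \<and> prob_space M"
  by (simp add: space_prob_algebra)

text \<open>If the codes of two sequences converge to the same \<open>z\<close>, interleaving the
  sequences gives another one with convergent codes, hence a convergent one; so both have the same
  limit. That common limit is the decoded value of \<open>z\<close>, also when \<open>z\<close> lies
  in the closure without being a code. Constant sequences show that the decoding inverts
  \<open>s\<close>.\<close>

lemma continuous_left_inverse_extension:
  fixes s :: "'a::metric_space \<Rightarrow> real"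
  assumes conv: "\<And>x. convergent (\<lambda>n. s (x n)) \<Longrightarrow> convergent x"
  obtains h where "continuous_on (closure (range s)) h" and "\<And>x. h (s x) = x"
proof -
  define h where "h z = (SOME l. \<forall>x. (\<lambda>n. s (x n)) \<longlonglongrightarrow> z \<longrightarrow> x \<longlonglongrightarrow> l)" for z
  have lim: "x \<longlonglongrightarrow> h z" if x: "(\<lambda>n. s (x n)) \<longlonglongrightarrow> z" for x z
  proof -
    obtain l where l: "x \<longlonglongrightarrow> l" using conv x by (auto simp: convergent_def)
    have "\<forall>y. (\<lambda>n. s (y n)) \<longlonglongrightarrow> z \<longrightarrow> y \<longlonglongrightarrow> l"
    proof (intro allI impI)
      fix y assume y: "(\<lambda>n. s (y n)) \<longlonglongrightarrow> z"
      define w where "w n = (if even n then x n else y n)" for n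
      have "(\<lambda>n. s (w n)) \<longlonglongrightarrow> z"
        unfolding tendsto_iff
      proof (intro allI impI)
        fix e :: real assume "e > 0"
        with x y have "eventually (\<lambda>n. dist (s (x n)) z < e) sequentially"
          "eventually (\<lambda>n. dist (s (y n)) z < e) sequentially" by (auto simp: tendsto_iff)
        thus "eventually (\<lambda>n. dist (s (w n)) z < e) sequentially"
          by eventually_elim (simp add: w_def)
      qed
      then obtain m where m: "w \<longlonglongrightarrow> m" using conv by (auto simp: convergent_def)
      have "(\<lambda>n. w (2 * n)) \<longlonglongrightarrow> m" "(\<lambda>n. w (2 * n + 1)) \<longlonglongrightarrow> m"
        using LIMSEQ_subseq_LIMSEQ[OF m, of "\<lambda>n. 2 * n"] LIMSEQ_subseq_LIMSEQ[OF m, of "\<lambda>n. 2 * n + 1"]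
        by (auto simp: strict_mono_def o_def)
      moreover have "(\<lambda>n. x (2 * n)) \<longlonglongrightarrow> l"
        using LIMSEQ_subseq_LIMSEQ[OF l, of "\<lambda>n. 2 * n"] by (auto simp: strict_mono_def o_def)
      ultimately have "m = l" and y1: "(\<lambda>n. y (2 * n + 1)) \<longlonglongrightarrow> m"
        using LIMSEQ_unique by (auto simp: w_def)
      obtain k where k: "y \<longlonglongrightarrow> k" using conv y by (auto simp: convergent_def)
      have "(\<lambda>n. y (2 * n + 1)) \<longlonglongrightarrow> k"
        using LIMSEQ_subseq_LIMSEQ[OF k, of "\<lambda>n. 2 * n + 1"] by (auto simp: strict_mono_def o_def)
      hence "k = m" using y1 LIMSEQ_unique by blast
      with k \<open>m = l\<close> show "y \<longlonglongrightarrow> l" by simp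
    qed
    hence "\<forall>x. (\<lambda>n. s (x n)) \<longlonglongrightarrow> z \<longrightarrow> x \<longlonglongrightarrow> h z"
      unfolding h_def by (rule someI)
    with x show ?thesis by blast
  qed
  have hs: "h (s x) = x" for x
    using lim[of "\<lambda>_. x" "s x"] by (simp add: LIMSEQ_const_iff)
  have "continuous_on (closure (range s)) h"
  proof (rule continuous_on_sequentiallyI)
    fix u a assume u: "\<forall>n. u n \<in> closure (range s)" "a \<in> closure (range s)" "u \<longlonglongrightarrow> a"
    \<comment> \<open>Each \<open>u n\<close> is replaced by a genuine code within 1/(n+1), chosen
      so that the decoded points are equally close. Continuity at \<open>a\<close> then reduces to
      sequences of codes, for which \<open>lim\<close> is available.\<close>
    have "\<exists>x. dist (s x) (u n) < inverse (Suc n) \<and> dist x (h (u n)) < inverse (Suc n)" for n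
    proof -
      obtain v where v: "\<forall>k. v k \<in> range s" "v \<longlonglongrightarrow> u n"
        using u(1)[rule_format, of n] unfolding closure_sequential by blast
      from v(1) have "\<forall>k. \<exists>x. v k = s x" by blast
      then obtain x where x: "\<forall>k. v k = s (x k)" by (rule choice[THEN exE])
      have "v = (\<lambda>k. s (x k))" using x by auto
      hence s1: "(\<lambda>k. s (x k)) \<longlonglongrightarrow> u n" using v(2) by simp
      have pos: "0 < inverse (real (Suc n))" by simp
      have "eventually (\<lambda>k. dist (s (x k)) (u n) < inverse (Suc n)) sequentially"
        by (rule tendstoD[OF s1 pos])
      moreover have "eventually (\<lambda>k. dist (x k) (h (u n)) < inverse (Suc n)) sequentially"
        by (rule tendstoD[OF lim[OF s1] pos])
      ultimately have "eventually (\<lambda>k. dist (s (x k)) (u n) < inverse (Suc n) \<and> dist (x k) (h (u n)) < inverse (Suc n)) sequentially"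
        by eventually_elim simp
      thus ?thesis by (blast dest: eventually_happens'[OF sequentially_bot])
    qed
    then obtain x where x: "\<And>n. dist (s (x n)) (u n) < inverse (Suc n)"
      "\<And>n. dist (x n) (h (u n)) < inverse (Suc n)" by metis
    have z: "(\<lambda>n. inverse (real (Suc n))) \<longlonglongrightarrow> 0" by (rule LIMSEQ_inverse_real_of_nat)
    have d0: "(\<lambda>n. dist (s (x n)) (u n)) \<longlonglongrightarrow> 0" "(\<lambda>n. dist (h (u n)) (x n)) \<longlonglongrightarrow> 0"
      by (rule tendsto_sandwich[OF always_eventually always_eventually tendsto_const z];
          use x in \<open>simp add: less_imp_le dist_commute del: of_nat_Suc\<close>)+
    have "(\<lambda>n. s (x n)) \<longlonglongrightarrow> a"
      by (rule Lim_transform[OF u(3)]) (use d0(1) in \<open>auto simp: tendsto_iff dist_real_def\<close>)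
    hence "x \<longlonglongrightarrow> h a" by (rule lim)
    show "(\<lambda>n. h (u n)) \<longlonglongrightarrow> h a"
      unfolding tendsto_iff
    proof (intro allI impI)
      fix e :: real assume e: "e > 0"
      have "eventually (\<lambda>n. dist (x n) (h a) < e/2) sequentially"
        using \<open>x \<longlonglongrightarrow> h a\<close> half_gt_zero[OF e] by (rule tendstoD)
      moreover have "eventually (\<lambda>n. dist (h (u n)) (x n) < e/2) sequentially"
        using tendstoD[OF d0(2) half_gt_zero[OF e]] by simp
      ultimately show "eventually (\<lambda>n. dist (h (u n)) (h a) < e) sequentially"
        by eventually_elim (rule dist_triangle_half_l, simp_all add: dist_commute)
    qed
  qed
  thus ?thesis using hs by (rule that)
qed

section \<open>Tightness from moments, Prokhorov and Skorokhod\<close>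

text \<open>Markov's inequality for \<open>V\<close>, carried over to \<open>s\<close> because the
  two differ by at most 2.\<close>

lemma tight_distr_if_moment_bound:
  fixes V :: "'a::topological_space \<Rightarrow> real" and P :: "nat \<Rightarrow> 'a measure"
  assumes s: "s \<in> borel_measurable borel" "\<And>x. \<bar>s x - V x\<bar> \<le> 2"
    and V: "V \<in> borel_measurable borel" "\<And>x. 0 \<le> V x"
    and P: "\<And>n. P n \<in> borel_probs"
    and bound: "\<And>n. (\<integral>\<^sup>+x. ennreal (V x) \<partial>P n) \<le> ennreal B"
  shows "tight (\<lambda>n. distr (P n) borel s)"
  unfolding tight_def
proof (intro conjI allI impI)
  note [measurable] = s(1) V(1)
  have sets[measurable_cong]: "sets (P n) = sets borel" for n using P by (simp add: borel_probs_iff)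
  have ps: "prob_space (P n)" for n using P by (simp add: borel_probs_iff)
  show "real_distribution (distr (P n) borel s)" for n
  proof -
    interpret prob_space "P n" by (rule ps)
    show ?thesis by (rule real_distribution_distr) measurable
  qed
  fix e :: real assume e: "e > 0"
  \<comment> \<open>The added 1 keeps \<open>r\<close> positive when \<open>B\<close> is 0 and makes
    B / r < e strict.\<close>
  define r where "r = (\<bar>B\<bar> + 1) / e"
  have r: "r > 0" using e by (simp add: r_def)
  have "e * r = \<bar>B\<bar> + 1" using e by (simp add: r_def)
  hence Br: "B / r < e" unfolding pos_divide_less_eq[OF r] by linarith
  show "\<exists>a b. a < b \<and> (\<forall>n. 1 - e < measure (distr (P n) borel s) {a<..b})"
  \<comment> \<open>As \<open>V\<close> is nonnegative, \<open>s\<close> is at least -2; the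
    interval is open on the left, so -3 is a safe end. On the other side, \<open>V\<close> < r gives
    values of \<open>s\<close> below r + 2.\<close>
  proof (rule exI[of _ "-3"], rule exI[of _ "r + 2"], intro conjI allI)
    show "-3 < r + 2" using r by simp
    fix n
    interpret prob_space "P n" by (rule ps)
    have "ennreal (measure (P n) {x\<in>space (P n). V x \<ge> r}) \<le> ennreal (1 / r) * (\<integral>\<^sup>+x. ennreal (V x) * indicator (space (P n)) x \<partial>P n)"
    proof -
      have "emeasure (P n) {x\<in>space (P n). 1 \<le> ennreal (1/r) * ennreal (V x)}
         \<le> ennreal (1/r) * (\<integral>\<^sup>+x. ennreal (V x) * indicator (space (P n)) x \<partial>P n)"
        by (rule nn_integral_Markov_inequality) measurable
      also have "{x\<in>space (P n). 1 \<le> ennreal (1/r) * ennreal (V x)} = {x\<in>space (P n). V x \<ge> r}"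
        using r V(2) by (auto simp: ennreal_mult[symmetric] field_simps simp flip: ennreal_1)
      finally show ?thesis by (simp add: emeasure_eq_measure)
    qed
    also have "(\<integral>\<^sup>+x. ennreal (V x) * indicator (space (P n)) x \<partial>P n) = (\<integral>\<^sup>+x. ennreal (V x) \<partial>P n)"
      by (intro nn_integral_cong) simp
    also have "ennreal (1 / r) * \<dots> \<le> ennreal (1 / r) * ennreal B"
      by (intro mult_left_mono bound) simp
    also have "\<dots> = ennreal (B / r)" using r by (simp add: ennreal_mult'[symmetric])
    finally have 1: "measure (P n) {x\<in>space (P n). V x \<ge> r} < e"
      using Br e by (cases "B / r \<ge> 0") (auto simp: ennreal_le_iff ennreal_neg)
    have "measure (distr (P n) borel s) {-3<..r+2} = measure (P n) (s -` {-3<..r+2} \<inter> space (P n))"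
      by (rule measure_distr) measurable
    also have "\<dots> \<ge> measure (P n) (space (P n) - {x\<in>space (P n). V x \<ge> r})"
    proof (rule finite_measure_mono)
      show "space (P n) - {x \<in> space (P n). r \<le> V x} \<subseteq> s -` {- 3<..r + 2} \<inter> space (P n)"
      proof
        fix x assume "x \<in> space (P n) - {x \<in> space (P n). r \<le> V x}"
        thus "x \<in> s -` {- 3<..r + 2} \<inter> space (P n)"
          using s(2)[of x] V(2)[of x] by (auto simp: abs_le_iff)
      qed
    qed measurable
    moreover have "measure (P n) (space (P n) - {x\<in>space (P n). V x \<ge> r}) = 1 - measure (P n) {x\<in>space (P n). V x \<ge> r}"
      by (rule prob_compl) measurable
    ultimately show "1 - e < measure (distr (P n) borel s) {-3<..r+2}"
      using 1 by linarith
  qed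
qed

text \<open>Prokhorov's theorem together with Skorokhod's representation: both are transported from the
  real line by a Borel coding whose inverse is continuous.\<close>

theorem prokhorov_skorohod:
  fixes V :: "'a::{second_countable_topology,metric_space} \<Rightarrow> real" and P :: "nat \<Rightarrow> 'a measure"
  assumes V: "continuous_on UNIV V" "\<And>r. compact {x. V x \<le> r}" "\<And>x. 0 \<le> V x"
    and P: "\<And>n. P n \<in> borel_probs"
    and bound: "\<And>n. (\<integral>\<^sup>+x. ennreal (V x) \<partial>P n) \<le> ennreal B"
  obtains r and \<Omega> :: "real measure" and X :: "nat \<Rightarrow> real \<Rightarrow> 'a" and Y
  where "strict_mono r" "prob_space \<Omega>"
    "\<forall>n. X n \<in> borel_measurable \<Omega>" "\<forall>n. distr \<Omega> borel (X n) = P (r n)"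
    "Y \<in> borel_measurable \<Omega>" "AE \<omega> in \<Omega>. (\<lambda>n. X n \<omega>) \<longlonglongrightarrow> Y \<omega>"
proof -
  obtain s where s: "s \<in> borel_measurable borel" "\<And>x. \<bar>s x - V x\<bar> \<le> 2"
    "\<And>x :: nat \<Rightarrow> 'a. convergent (\<lambda>n. s (x n)) \<Longrightarrow> convergent x"
    using real_coding[OF V(1,2)] by blast
  obtain h where h: "continuous_on (closure (range s)) h" "\<And>x. h (s x) = x"
    using continuous_left_inverse_extension[OF s(3)] by blast
  define C where "C = closure (range s)"
  \<comment> \<open>Off the closed set \<open>C\<close> some fixed point is used as default value:
    which one is irrelevant, and a constant keeps \<open>h'\<close> Borel.\<close>
  define h' where "h' z = (if z \<in> C then h z else h (s undefined))" for z
  have C: "closed C" by (simp add: C_def)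
  have sC: "s x \<in> C" for x unfolding C_def by (rule subsetD[OF closure_subset]) simp
  have h'm[measurable]: "h' \<in> borel_measurable borel"
    unfolding h'_def using C h(1)
    by (intro borel_measurable_continuous_on_if) (auto simp: C_def)
  have h's: "h' (s x) = x" for x by (simp add: h'_def sC h(2))
  have Vm: "V \<in> borel_measurable borel" using V(1) by (rule borel_measurable_continuous_onI)
  define \<mu> where "\<mu> n = distr (P n) borel s" for n
  have "tight \<mu>"
    unfolding \<mu>_def by (rule tight_distr_if_moment_bound[OF s(1,2) Vm V(3) P bound])
  then obtain r M where r: "strict_mono r" "real_distribution M" "weak_conv_m (\<mu> \<circ> id \<circ> r) M"
    using tight_imp_convergent_subsubsequence[of \<mu> id] by (auto simp: strict_mono_id)
  have \<mu>r: "real_distribution ((\<mu> \<circ> id \<circ> r) n)" for n using \<open>tight \<mu>\<close> by (simp add: tight_def)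
  obtain \<Omega> :: "real measure" and Z :: "nat \<Rightarrow> real \<Rightarrow> real" and W where
    \<Omega>: "prob_space \<Omega>" "\<And>n. Z n \<in> measurable \<Omega> borel" "\<And>n. distr \<Omega> borel (Z n) = (\<mu> \<circ> id \<circ> r) n"
      "W \<in> measurable \<Omega> lborel" "\<And>x. x \<in> space \<Omega> \<Longrightarrow> (\<lambda>n. Z n x) \<longlonglongrightarrow> W x"
    using Skorohod[OF \<mu>r r(2,3)] by blast
  note [measurable] = \<Omega>(2) s(1)
  have [measurable]: "W \<in> borel_measurable \<Omega>" using \<Omega>(4) by simp
  have sets[measurable_cong]: "sets (P n) = sets borel" for n using P by (simp add: borel_probs_iff)
  have inC: "AE \<omega> in \<Omega>. Z n \<omega> \<in> C" for n
  proof -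
    have "AE z in distr (P (r n)) borel s. z \<in> C"
      using C by (subst AE_distr_iff) (auto simp: sC)
    hence "AE z in distr \<Omega> borel (Z n). z \<in> C" unfolding \<Omega>(3) by (simp only: \<mu>_def o_def id_def)
    thus ?thesis using C by (subst (asm) AE_distr_iff) auto
  qed
  show ?thesis
  proof (rule that[OF r(1) \<Omega>(1), of "\<lambda>n \<omega>. h' (Z n \<omega>)" "\<lambda>\<omega>. h' (W \<omega>)"])
    show "\<forall>n. (\<lambda>\<omega>. h' (Z n \<omega>)) \<in> borel_measurable \<Omega>" by (intro allI) measurable
    show "(\<lambda>\<omega>. h' (W \<omega>)) \<in> borel_measurable \<Omega>" by measurable
    show "\<forall>n. distr \<Omega> borel (\<lambda>\<omega>. h' (Z n \<omega>)) = P (r n)"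
    proof
      fix n
      have "distr \<Omega> borel (\<lambda>\<omega>. h' (Z n \<omega>)) = distr (distr \<Omega> borel (Z n)) borel h'"
        by (subst distr_distr) (auto simp: o_def)
      also have "\<dots> = distr (distr (P (r n)) borel s) borel h'" by (simp add: \<Omega>(3) \<mu>_def)
      also have "\<dots> = distr (P (r n)) borel (\<lambda>x. x)"
        by (subst distr_distr) (auto simp: o_def h's)
      also have "\<dots> = P (r n)" by (rule distr_id2) (simp add: sets)
      finally show "distr \<Omega> borel (\<lambda>\<omega>. h' (Z n \<omega>)) = P (r n)" .
    qed
    have "AE \<omega> in \<Omega>. \<forall>n. Z n \<omega> \<in> C" using inC by (simp add: AE_all_countable)
    thus "AE \<omega> in \<Omega>. (\<lambda>n. h' (Z n \<omega>)) \<longlonglongrightarrow> h' (W \<omega>)"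
    proof (rule AE_mp, intro AE_I2 impI)
      fix \<omega> assume \<omega>: "\<omega> \<in> space \<Omega>" "\<forall>n. Z n \<omega> \<in> C"
      \<comment> \<open>\<open>W \<omega>\<close> is a limit of codes but need not be a code, which
        is why the decoding has to be continuous on the closure.\<close>
      have "W \<omega> \<in> C" by (rule closed_sequentially[OF C _ \<Omega>(5)]) (use \<omega> in auto)
      moreover have "(\<lambda>n. h (Z n \<omega>)) \<longlonglongrightarrow> h (W \<omega>)"
        by (rule continuous_on_tendsto_compose[OF h(1) \<Omega>(5)])
           (use \<omega> \<open>W \<omega> \<in> C\<close> in \<open>auto simp: C_def\<close>)
      ultimately show "(\<lambda>n. h' (Z n \<omega>)) \<longlonglongrightarrow> h' (W \<omega>)" using \<omega> by (simp add: h'_def)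
    qed
  qed
qed

section \<open>Limits of laws and of integrals\<close>

lemma real_integral_limit_law:
  fixes f :: "'a::{second_countable_topology,metric_space} \<Rightarrow> real"
  assumes "prob_space \<Omega>" "\<And>n. X n \<in> borel_measurable \<Omega>" "Y \<in> borel_measurable \<Omega>"
    and "AE \<omega> in \<Omega>. (\<lambda>n. X n \<omega>) \<longlonglongrightarrow> Y \<omega>"
    and f: "continuous_on UNIV f" "\<And>x. \<bar>f x\<bar> \<le> C"
  shows "(\<lambda>n. \<integral>\<omega>. f (X n \<omega>) \<partial>\<Omega>) \<longlonglongrightarrow> (\<integral>\<omega>. f (Y \<omega>) \<partial>\<Omega>)"
proof (rule integral_dominated_convergence[where w = "\<lambda>_. C"])
  interpret prob_space \<Omega> by fact
  have [measurable]: "f \<in> borel_measurable borel" using f(1) by (rule borel_measurable_continuous_onI)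
  note [measurable] = assms(2,3)
  show "(\<lambda>\<omega>. f (Y \<omega>)) \<in> borel_measurable \<Omega>" "\<And>n. (\<lambda>\<omega>. f (X n \<omega>)) \<in> borel_measurable \<Omega>" by measurable
  show "integrable \<Omega> (\<lambda>_. C)" by simp
  show "AE \<omega> in \<Omega>. (\<lambda>n. f (X n \<omega>)) \<longlonglongrightarrow> f (Y \<omega>)"
    using assms(4) by eventually_elim (auto intro: continuous_on_tendsto_compose[OF f(1)])
  show "AE \<omega> in \<Omega>. norm (f (X n \<omega>)) \<le> C" for n by (simp add: f(2))
qed

text \<open>Expectations of bounded continuous functions pass to almost sure limits, so they agree
  for both limits; they determine the mass of closed sets, which form a generator stable under
  intersection. As the two probability spaces may differ, this identifies a limit obtained from one
  representation with a limit obtained from another.\<close>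

lemma limit_law_unique:
  fixes X :: "nat \<Rightarrow> 'b \<Rightarrow> 'a::{second_countable_topology,metric_space}" and X' :: "nat \<Rightarrow> 'c \<Rightarrow> 'a"
  assumes X: "prob_space \<Omega>" "\<And>n. X n \<in> borel_measurable \<Omega>" "Y \<in> borel_measurable \<Omega>"
      "AE \<omega> in \<Omega>. (\<lambda>n. X n \<omega>) \<longlonglongrightarrow> Y \<omega>"
    and X': "prob_space \<Omega>'" "\<And>n. X' n \<in> borel_measurable \<Omega>'" "Y' \<in> borel_measurable \<Omega>'"
      "AE \<omega> in \<Omega>'. (\<lambda>n. X' n \<omega>) \<longlonglongrightarrow> Y' \<omega>"
    and eq: "\<And>n. distr \<Omega> borel (X n) = distr \<Omega>' borel (X' n)"
  shows "distr \<Omega> borel Y = distr \<Omega>' borel Y'"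
proof -
  interpret \<Omega>: prob_space \<Omega> by fact
  interpret \<Omega>': prob_space \<Omega>' by fact
  interpret Y: prob_space "distr \<Omega> borel Y" by (rule \<Omega>.prob_space_distr) fact
  interpret Y': prob_space "distr \<Omega>' borel Y'" by (rule \<Omega>'.prob_space_distr) fact
  have int_eq: "(\<integral>x. f x \<partial>distr \<Omega> borel Y) = (\<integral>x. f x \<partial>distr \<Omega>' borel Y')"
    if f: "continuous_on UNIV f" "\<And>x. \<bar>f x\<bar> \<le> C" for f :: "'a \<Rightarrow> real" and C
  proof -
    have fm: "f \<in> borel_measurable borel" using f(1) by (rule borel_measurable_continuous_onI)
    have "(\<integral>\<omega>. f (X n \<omega>) \<partial>\<Omega>) = (\<integral>\<omega>. f (X' n \<omega>) \<partial>\<Omega>')" for n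
      using integral_distr[OF X(2) fm, of n] integral_distr[OF X'(2) fm, of n] eq[of n] by simp
    with real_integral_limit_law[OF X f] real_integral_limit_law[OF X' f]
    have "(\<integral>\<omega>. f (Y \<omega>) \<partial>\<Omega>) = (\<integral>\<omega>. f (Y' \<omega>) \<partial>\<Omega>')" by (simp add: LIMSEQ_unique)
    thus ?thesis by (simp add: integral_distr X(3) X'(3) fm)
  qed
  have closed_eq: "emeasure (distr \<Omega> borel Y) A = emeasure (distr \<Omega>' borel Y') A" if A: "closed A" for A
  proof (cases "A = {}")
    case False
    \<comment> \<open>Continuous functions that decrease pointwise to the indicator of the closed
      set \<open>A\<close>. The empty set is treated apart because \<open>infdist x {}\<close> is 0
      by convention, which would give the constant 1.\<close>
    define f where "f k x = max 0 (1 - real k * infdist x A)" for k x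
    have fc: "continuous_on UNIV (f k)" for k
      unfolding f_def by (intro continuous_intros)
    have fb: "\<bar>f k x\<bar> \<le> 1" for k x using infdist_nonneg[of x A] by (simp add: f_def)
    have flim: "(\<lambda>k. f k x) \<longlonglongrightarrow> indicator A x" for x
    proof (cases "x \<in> A")
      case True
      thus ?thesis by (simp add: f_def)
    next
      case False
      hence pos: "infdist x A > 0"
        using in_closed_iff_infdist_zero[OF A \<open>A \<noteq> {}\<close>] infdist_nonneg[of x A] by (metis less_eq_real_def)
      obtain K :: nat where K: "1 < real K * infdist x A" using pos reals_Archimedean3 by blast
      have "f k x = 0" if "k \<ge> K" for k
      proof -
        have "real K * infdist x A \<le> real k * infdist x A" using that pos by (intro mult_right_mono) auto
        with K show ?thesis by (simp add: f_def)
      qed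
      hence "eventually (\<lambda>k. f k x = 0) sequentially" by (auto simp: eventually_sequentially)
      with False show ?thesis by (simp add: tendsto_eventually)
    qed
    have lim: "(\<lambda>k. \<integral>x. f k x \<partial>distr P borel Z) \<longlonglongrightarrow> measure (distr P borel Z) A"
      if P: "prob_space (distr P borel Z)" for P :: "'d measure" and Z
    proof -
      interpret prob_space "distr P borel Z" by (rule P)
      have "(\<lambda>k. \<integral>x. f k x \<partial>distr P borel Z) \<longlonglongrightarrow> (\<integral>x. indicator A x \<partial>distr P borel Z)"
        by (rule integral_dominated_convergence[where w = "\<lambda>_. 1"])
           (use A fb in \<open>auto simp: flim intro: borel_measurable_continuous_onI[OF fc]\<close>)
      thus ?thesis using A by simp
    qed
    have "measure (distr \<Omega> borel Y) A = measure (distr \<Omega>' borel Y') A"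
      using lim[OF Y.prob_space_axioms] lim[OF Y'.prob_space_axioms] int_eq[OF fc fb]
      by (simp add: LIMSEQ_unique)
    thus ?thesis by (simp add: Y.emeasure_eq_measure Y'.emeasure_eq_measure)
  qed simp
  show ?thesis
  proof (rule measure_eqI_generator_eq[where E = "Collect closed" and \<Omega> = UNIV and A = "\<lambda>_. UNIV"])
    show "Int_stable (Collect closed :: 'a set set)" by (auto simp: Int_stable_def)
    show "sets (distr \<Omega> borel Y) = sigma_sets UNIV (Collect closed)"
      "sets (distr \<Omega>' borel Y') = sigma_sets UNIV (Collect closed)"
      by (simp_all add: borel_eq_closed)
  qed (auto simp: closed_eq)
qed

text \<open>Clipping \<open>h\<close> at height \<open>R\<close> changes it by at most e V, so the
  error in the integral is at most e |B| for all the variables at once; this is uniform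
  integrability by hand. The clipped function is bounded, and dominated convergence applies to
  it.\<close>

lemma integral_tendsto_dominated_growth:
  fixes h V :: "'a::{second_countable_topology,metric_space} \<Rightarrow> real"
  assumes X: "prob_space \<Omega>" "\<And>n. X n \<in> borel_measurable \<Omega>" "Y \<in> borel_measurable \<Omega>"
      "AE \<omega> in \<Omega>. (\<lambda>n. X n \<omega>) \<longlonglongrightarrow> Y \<omega>"
    and h: "continuous_on UNIV h"
    and growth: "\<And>e. e > 0 \<Longrightarrow> \<exists>R. \<forall>x. \<bar>h x\<bar> \<le> R + e * V x"
    and V: "V \<in> borel_measurable borel" "\<And>x. 0 \<le> V x"
    and bound: "\<And>n. (\<integral>\<^sup>+\<omega>. ennreal (V (X n \<omega>)) \<partial>\<Omega>) \<le> ennreal B" "(\<integral>\<^sup>+\<omega>. ennreal (V (Y \<omega>)) \<partial>\<Omega>) \<le> ennreal B"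
  shows "(\<lambda>n. \<integral>\<omega>. h (X n \<omega>) \<partial>\<Omega>) \<longlonglongrightarrow> (\<integral>\<omega>. h (Y \<omega>) \<partial>\<Omega>)"
proof -
  interpret prob_space \<Omega> by fact
  note [measurable] = X(2,3) V(1) borel_measurable_continuous_onI[OF h]
  define clamp where "clamp R t = max (-R) (min R t)" for R t :: real
  have trunc: "\<bar>(\<integral>\<omega>. h (Z \<omega>) \<partial>\<Omega>) - (\<integral>\<omega>. clamp R (h (Z \<omega>)) \<partial>\<Omega>)\<bar> \<le> e * \<bar>B\<bar>"
    if Z[measurable]: "Z \<in> borel_measurable \<Omega>" and bZ: "(\<integral>\<^sup>+\<omega>. ennreal (V (Z \<omega>)) \<partial>\<Omega>) \<le> ennreal B"
      and R: "R \<ge> 0" "\<And>x. \<bar>h x\<bar> \<le> R + e * V x" and e: "e > 0" for Z R e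
  proof -
    have iV: "integrable \<Omega> (\<lambda>\<omega>. V (Z \<omega>))"
      by (rule integrableI_nonneg) (use V(2) bZ in \<open>auto simp: le_less_trans\<close>)
    have "ennreal (\<integral>\<omega>. V (Z \<omega>) \<partial>\<Omega>) \<le> ennreal B"
      using bZ nn_integral_eq_integral[OF iV] V(2) by simp
    also have "\<dots> \<le> ennreal \<bar>B\<bar>" by (rule ennreal_leI) simp
    finally have VB: "(\<integral>\<omega>. V (Z \<omega>) \<partial>\<Omega>) \<le> \<bar>B\<bar>" by (simp add: ennreal_le_iff)
    have ih: "integrable \<Omega> (\<lambda>\<omega>. h (Z \<omega>))"
      by (rule Bochner_Integration.integrable_bound[of _ "\<lambda>\<omega>. R + e * V (Z \<omega>)"])
         (use iV in \<open>auto intro: order_trans[OF R(2) abs_ge_self]\<close>)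
    have ic: "integrable \<Omega> (\<lambda>\<omega>. clamp R (h (Z \<omega>)))"
      by (rule integrable_const_bound[of _ R]) (use R(1) in \<open>auto simp: clamp_def\<close>)
    have "\<bar>(\<integral>\<omega>. h (Z \<omega>) \<partial>\<Omega>) - (\<integral>\<omega>. clamp R (h (Z \<omega>)) \<partial>\<Omega>)\<bar> = \<bar>\<integral>\<omega>. h (Z \<omega>) - clamp R (h (Z \<omega>)) \<partial>\<Omega>\<bar>"
      by (simp add: ih ic)
    also have "\<dots> \<le> (\<integral>\<omega>. \<bar>h (Z \<omega>) - clamp R (h (Z \<omega>))\<bar> \<partial>\<Omega>)" by (rule integral_abs_bound)
    also have "\<dots> \<le> (\<integral>\<omega>. e * V (Z \<omega>) \<partial>\<Omega>)"
    proof (rule integral_mono)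
      fix \<omega>
      have "0 \<le> e * V (Z \<omega>)" using e V(2) by simp
      thus "\<bar>h (Z \<omega>) - clamp R (h (Z \<omega>))\<bar> \<le> e * V (Z \<omega>)"
        using R(1) R(2)[of "Z \<omega>"] unfolding clamp_def by linarith
    qed (use ih ic iV in auto)
    also have "\<dots> \<le> e * \<bar>B\<bar>" using VB e by simp
    finally show ?thesis .
  qed
  show ?thesis
  proof (rule LIMSEQ_I)
    fix r :: real assume r: "r > 0"
    \<comment> \<open>The two truncations and the convergence of the clipped integrals each get a
      share of r / 3; the 1 in the denominator covers \<open>B\<close> = 0.\<close>
    define e where "e = r / 3 / (\<bar>B\<bar> + 1)"
    have e: "e > 0" using r by (simp add: e_def)
    have "\<bar>B\<bar> + 1 \<noteq> 0" by linarith
    hence "e * (\<bar>B\<bar> + 1) = r / 3" unfolding e_def by (rule nonzero_eq_divide_eq[THEN iffD1, OF _ refl])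
    hence eB: "e * \<bar>B\<bar> < r / 3" using e by (simp add: algebra_simps)
    obtain R0 where R0: "\<forall>x. \<bar>h x\<bar> \<le> R0 + e * V x" using growth[OF e] by blast
    define R where "R = max R0 0"
    have R: "R \<ge> 0" "\<And>x. \<bar>h x\<bar> \<le> R + e * V x"
      using R0 by (auto simp: R_def intro: order_trans)
    have "(\<lambda>n. \<integral>\<omega>. clamp R (h (X n \<omega>)) \<partial>\<Omega>) \<longlonglongrightarrow> (\<integral>\<omega>. clamp R (h (Y \<omega>)) \<partial>\<Omega>)"
      by (rule real_integral_limit_law[OF X, of "\<lambda>x. clamp R (h x)" R])
         (use R(1) in \<open>auto simp: clamp_def intro!: continuous_intros h\<close>)
    then obtain N where N: "\<And>n. n \<ge> N \<Longrightarrow> \<bar>(\<integral>\<omega>. clamp R (h (X n \<omega>)) \<partial>\<Omega>) - (\<integral>\<omega>. clamp R (h (Y \<omega>)) \<partial>\<Omega>)\<bar> < r / 3"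
      using LIMSEQ_D[of _ _ "r / 3"] r by (metis real_norm_def zero_less_divide_iff zero_less_numeral)
    show "\<exists>N. \<forall>n\<ge>N. norm ((\<integral>\<omega>. h (X n \<omega>) \<partial>\<Omega>) - (\<integral>\<omega>. h (Y \<omega>) \<partial>\<Omega>)) < r"
    proof (intro exI[of _ N] allI impI)
      fix n assume "n \<ge> N"
      from N[OF this] trunc[OF X(2) bound(1) R e, of n] trunc[OF X(3) bound(2) R e] eB
      show "norm ((\<integral>\<omega>. h (X n \<omega>) \<partial>\<Omega>) - (\<integral>\<omega>. h (Y \<omega>) \<partial>\<Omega>)) < r"
        unfolding real_norm_def by linarith
    qed
  qed
qed

section \<open>Convex combinations of laws\<close>

text \<open>For t in [0, 1] this is t M + (1 - t) N, written as a random choice between the two laws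
  so that the calculus of \<open>bind\<close> yields measurability, images and integrals.\<close>

definition mixture :: "real \<Rightarrow> 'a measure \<Rightarrow> 'a measure \<Rightarrow> 'a measure" where
  "mixture t M N = measure_pmf (bernoulli_pmf t) \<bind> (\<lambda>b. if b then M else N)"

context
  fixes M N :: "'a::topological_space measure"
  assumes MN: "M \<in> borel_probs" "N \<in> borel_probs"
begin

lemma mixture_kernel:
  "(\<lambda>b. if b then M else N) \<in> measure_pmf (bernoulli_pmf t) \<rightarrow>\<^sub>M prob_algebra borel"
  using MN by simp

lemma mixture_borel_probs: "mixture t M N \<in> borel_probs"
  unfolding mixture_def borel_probs_iff
proof
  show "sets (measure_pmf (bernoulli_pmf t) \<bind> (\<lambda>b. if b then M else N)) = sets borel"
    by (rule sets_bind) (use MN in \<open>auto simp: borel_probs_iff\<close>)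
  show "prob_space (measure_pmf (bernoulli_pmf t) \<bind> (\<lambda>b. if b then M else N))"
    by (rule prob_space.prob_space_bind[OF prob_space_measure_pmf _ measurable_prob_algebraD[OF mixture_kernel]])
       (use MN in \<open>auto simp: borel_probs_iff\<close>)
qed

lemma nn_integral_mixture:
  assumes "f \<in> borel_measurable borel" "0 \<le> t" "t \<le> 1"
  shows "(\<integral>\<^sup>+x. f x \<partial>mixture t M N) = ennreal t * (\<integral>\<^sup>+x. f x \<partial>M) + ennreal (1 - t) * (\<integral>\<^sup>+x. f x \<partial>N)"
  unfolding mixture_def
  by (subst nn_integral_bind[OF assms(1) measurable_prob_algebraD[OF mixture_kernel]])
     (use assms in \<open>simp add: mult.commute\<close>)

lemma distr_mixture:
  assumes "f \<in> borel_measurable borel"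
  shows "distr (mixture t M N) borel f = mixture t (distr M borel f) (distr N borel f)"
  unfolding mixture_def
  by (subst distr_bind[OF measurable_prob_algebraD[OF mixture_kernel] _ assms])
     (auto intro!: bind_cong)

end

lemma mixture_same: "M \<in> borel_probs \<Longrightarrow> mixture t M M = M"
  unfolding mixture_def if_cancel
  by (rule bind_const') (auto simp: borel_probs_iff prob_space_imp_subprob_space prob_space_measure_pmf)

lemma integral_mixture:
  fixes f :: "'a::topological_space \<Rightarrow> real"
  assumes MN: "M \<in> borel_probs" "N \<in> borel_probs"
    and f: "integrable M f" "integrable N f" and t: "0 \<le> t" "t \<le> 1"
    and fm: "f \<in> borel_measurable borel"
  shows "integrable (mixture t M N) f"
    and "(\<integral>x. f x \<partial>mixture t M N) = t * (\<integral>x. f x \<partial>M) + (1 - t) * (\<integral>x. f x \<partial>N)"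
proof -
  have sets: "sets (mixture t M N) = sets borel"
    using mixture_borel_probs[OF MN] by (simp add: borel_probs_iff)
  \<comment> \<open>Used for \<open>f\<close> and for \<open>- f\<close>, whose truncations by
    \<open>ennreal\<close> are the positive and the negative part of \<open>f\<close>. Passing
    through \<open>enn2real\<close> is harmless because integrability makes both integrals
    finite.\<close>
  have fin: "(\<integral>\<^sup>+x. ennreal (g x) \<partial>mixture t M N)
      = ennreal (t * enn2real (\<integral>\<^sup>+x. ennreal (g x) \<partial>M) + (1 - t) * enn2real (\<integral>\<^sup>+x. ennreal (g x) \<partial>N))"
    if g: "integrable M g" "integrable N g" "g \<in> borel_measurable borel" for g :: "'a \<Rightarrow> real"
  proof -
    have "(\<integral>\<^sup>+x. ennreal (g x) \<partial>M) < \<infinity>" "(\<integral>\<^sup>+x. ennreal (g x) \<partial>N) < \<infinity>"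
      using g by (auto simp: real_integrable_def less_top)
    then show ?thesis
      using g(3) t by (subst nn_integral_mixture[OF MN])
        (auto simp: ennreal_mult ennreal_enn2real)
  qed
  have m: "integrable M (\<lambda>x. - f x)" "integrable N (\<lambda>x. - f x)" "(\<lambda>x. - f x) \<in> borel_measurable borel"
    using f fm by auto
  show int: "integrable (mixture t M N) f"
    unfolding real_integrable_def using fin[OF f fm] fin[OF m] fm
    by (simp add: measurable_cong_sets[OF sets refl])
  have nn: "0 \<le> t * enn2real a + (1 - t) * enn2real b" for a b
    using t by simp
  show "(\<integral>x. f x \<partial>mixture t M N) = t * (\<integral>x. f x \<partial>M) + (1 - t) * (\<integral>x. f x \<partial>N)"
    unfolding real_lebesgue_integral_def[OF int] real_lebesgue_integral_def[OF f(1)]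
      real_lebesgue_integral_def[OF f(2)] fin[OF f fm] fin[OF m]
      enn2real_ennreal[OF nn]
    by (simp add: algebra_simps)
qed

section \<open>Transport costs: semicontinuity, near-optimal couplings, convexity\<close>

text \<open>Fatou's lemma, as lower semicontinuity of an expected cost. The bound may vary with
  \<open>n\<close> because the couplings to which it is applied are only nearly optimal, with slack
  tending to 0.\<close>

lemma nn_integral_limit_law_le:
  fixes c :: "'a::{second_countable_topology,metric_space} \<Rightarrow> real"
  assumes X: "\<And>n. X n \<in> borel_measurable \<Omega>" "Y \<in> borel_measurable \<Omega>"
      "AE \<omega> in \<Omega>. (\<lambda>n. X n \<omega>) \<longlonglongrightarrow> Y \<omega>"
    and c: "continuous_on UNIV c"
    and bound: "\<And>n. (\<integral>\<^sup>+\<omega>. ennreal (c (X n \<omega>)) \<partial>\<Omega>) \<le> b n" "b \<longlonglongrightarrow> \<beta>"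
  shows "(\<integral>\<^sup>+\<omega>. ennreal (c (Y \<omega>)) \<partial>\<Omega>) \<le> \<beta>"
proof -
  note [measurable] = X(1,2) borel_measurable_continuous_onI[OF c]
  have "(\<integral>\<^sup>+\<omega>. ennreal (c (Y \<omega>)) \<partial>\<Omega>) = (\<integral>\<^sup>+\<omega>. liminf (\<lambda>n. ennreal (c (X n \<omega>))) \<partial>\<Omega>)"
  proof (rule nn_integral_cong_AE)
    show "AE \<omega> in \<Omega>. ennreal (c (Y \<omega>)) = liminf (\<lambda>n. ennreal (c (X n \<omega>)))"
      using X(3)
    proof eventually_elim
      case (elim \<omega>)
      have "(\<lambda>n. ennreal (c (X n \<omega>))) \<longlonglongrightarrow> ennreal (c (Y \<omega>))"
        by (intro tendsto_ennrealI continuous_on_tendsto_compose[OF c elim]) auto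
      thus ?case by (simp add: lim_imp_Liminf)
    qed
  qed
  also have "\<dots> \<le> liminf (\<lambda>n. \<integral>\<^sup>+\<omega>. ennreal (c (X n \<omega>)) \<partial>\<Omega>)"
    by (rule nn_integral_liminf) measurable
  also have "\<dots> \<le> liminf b" by (rule Liminf_mono) (simp add: bound(1))
  also have "\<dots> = \<beta>" using bound(2) by (simp add: lim_imp_Liminf)
  finally show ?thesis .
qed

text \<open>The infimum is not known to be attained, hence the slack \<open>e\<close>. Nonnegativity
  of \<delta> makes the step from \<delta> to \<delta> + e strict after
  \<open>ennreal\<close>.\<close>

lemma transport_cost_le_obtains:
  assumes "transport_cost c \<mu> \<nu> \<le> ennreal \<delta>" "\<delta> \<ge> 0" "e > 0"
  obtains \<pi> where "\<pi> \<in> couplings \<mu> \<nu>" "(\<integral>\<^sup>+z. ennreal (c (fst z) (snd z)) \<partial>\<pi>) \<le> ennreal (\<delta> + e)"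
proof -
  have "ennreal \<delta> < ennreal (\<delta> + e)" using assms(2,3) by (simp add: ennreal_less_iff)
  with assms(1) have "transport_cost c \<mu> \<nu> < ennreal (\<delta> + e)" by (rule le_less_trans)
  thus ?thesis
    unfolding transport_cost_def INF_less_iff using that by (auto intro: less_imp_le)
qed

lemma fst_borel_measurable [measurable]:
  "fst \<in> borel_measurable (borel :: ('a::topological_space \<times> 'b::topological_space) measure)"
  by (intro borel_measurable_continuous_onI continuous_intros)

lemma snd_borel_measurable [measurable]:
  "snd \<in> borel_measurable (borel :: ('a::topological_space \<times> 'b::topological_space) measure)"
  by (intro borel_measurable_continuous_onI continuous_intros)

lemma distr_borel_probs:
  "M \<in> borel_probs \<Longrightarrow> q \<in> borel_measurable borel \<Longrightarrow> distr M borel q \<in> borel_probs"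
  by (auto simp: borel_probs_iff intro!: prob_space.prob_space_distr cong: measurable_cong_sets)

lemma couplings_mixture:
  assumes "\<pi> \<in> couplings \<mu> \<nu>" "\<pi>' \<in> couplings \<mu> \<nu>'"
  shows "mixture t \<pi> \<pi>' \<in> couplings \<mu> (mixture t \<nu> \<nu>')"
proof -
  have \<pi>: "\<pi> \<in> borel_probs" "\<pi>' \<in> borel_probs" using assms by (auto simp: couplings_def)
  have "\<mu> \<in> borel_probs"
    using assms(1) distr_borel_probs[OF \<pi>(1) fst_borel_measurable] by (simp add: couplings_def)
  thus ?thesis
    using assms by (auto simp: couplings_def mixture_borel_probs distr_mixture mixture_same)
qed

text \<open>Mixing near-optimal couplings gives a coupling of \<open>\<mu>\<close> with the mixed
  measure, at the mixed cost; letting the slack vanish gives convexity of transport balls.\<close>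

lemma transport_cost_mixture_le:
  assumes "transport_cost c \<mu> \<nu> \<le> ennreal \<delta>" "transport_cost c \<mu> \<nu>' \<le> ennreal \<delta>"
    and "\<delta> \<ge> 0" "0 \<le> t" "t \<le> 1"
    and c: "(\<lambda>z. c (fst z) (snd z)) \<in> borel_measurable borel"
  shows "transport_cost c \<mu> (mixture t \<nu> \<nu>') \<le> ennreal \<delta>"
proof (rule ennreal_le_epsilon)
  fix e :: real assume e: "e > 0"
  obtain \<pi> where \<pi>: "\<pi> \<in> couplings \<mu> \<nu>" "(\<integral>\<^sup>+z. ennreal (c (fst z) (snd z)) \<partial>\<pi>) \<le> ennreal (\<delta> + e)"
    using transport_cost_le_obtains[OF assms(1) \<open>\<delta> \<ge> 0\<close> e] .
  obtain \<pi>' where \<pi>': "\<pi>' \<in> couplings \<mu> \<nu>'" "(\<integral>\<^sup>+z. ennreal (c (fst z) (snd z)) \<partial>\<pi>') \<le> ennreal (\<delta> + e)"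
    using transport_cost_le_obtains[OF assms(2) \<open>\<delta> \<ge> 0\<close> e] .
  have b: "\<pi> \<in> borel_probs" "\<pi>' \<in> borel_probs" using \<pi>(1) \<pi>'(1) by (auto simp: couplings_def)
  have "transport_cost c \<mu> (mixture t \<nu> \<nu>') \<le> (\<integral>\<^sup>+z. ennreal (c (fst z) (snd z)) \<partial>mixture t \<pi> \<pi>')"
    unfolding transport_cost_def by (rule INF_lower[OF couplings_mixture[OF \<pi>(1) \<pi>'(1)]])
  also have "\<dots> = ennreal t * (\<integral>\<^sup>+z. ennreal (c (fst z) (snd z)) \<partial>\<pi>) + ennreal (1 - t) * (\<integral>\<^sup>+z. ennreal (c (fst z) (snd z)) \<partial>\<pi>')"
    by (rule nn_integral_mixture[OF b]) (use assms(4,5) c in auto)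
  also have "\<dots> \<le> ennreal t * ennreal (\<delta> + e) + ennreal (1 - t) * ennreal (\<delta> + e)"
    by (intro add_mono mult_left_mono \<pi>(2) \<pi>'(2)) auto
  also have "\<dots> = ennreal (\<delta> + e)"
    using assms(4,5) by (simp flip: distrib_right ennreal_plus)
  also have "\<dots> = ennreal \<delta> + ennreal e" using assms(3) e by simp
  finally show "transport_cost c \<mu> (mixture t \<nu> \<nu>') \<le> ennreal \<delta> + ennreal e" .
qed

text \<open>The diagonal coupling costs nothing. So a reference measure lies in its own ball of any
  radius, 0 included, which is what nonemptiness of the constraint sets rests on.\<close>

lemma transport_cost_same:
  assumes "\<mu> \<in> borel_probs" "\<And>x. c x x = 0" "(\<lambda>z. c (fst z) (snd z)) \<in> borel_measurable borel"
  shows "transport_cost c \<mu> \<mu> = 0"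
proof -
  have [measurable]: "(\<lambda>x. (x, x)) \<in> borel_measurable borel"
    by (intro borel_measurable_continuous_onI continuous_intros)
  note [measurable] = assms(3)
  have [measurable_cong]: "sets \<mu> = sets borel" using assms(1) by (simp add: borel_probs_iff)
  have "distr \<mu> borel (\<lambda>x. (x, x)) \<in> borel_probs"
    by (rule distr_borel_probs[OF assms(1)]) measurable
  hence "distr \<mu> borel (\<lambda>x. (x, x)) \<in> couplings \<mu> \<mu>"
    using assms(1)
    by (auto simp: couplings_def distr_distr o_def borel_probs_iff intro!: distr_id2)
  hence "transport_cost c \<mu> \<mu> \<le> (\<integral>\<^sup>+z. ennreal (c (fst z) (snd z)) \<partial>distr \<mu> borel (\<lambda>x. (x, x)))"
    unfolding transport_cost_def by (rule INF_lower)
  also have "\<dots> = 0" by (subst nn_integral_distr) (auto simp: assms(2))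
  finally show ?thesis by simp
qed

section \<open>Transport balls for powers of a proper metric\<close>

lemma compact_sublevel_subset:
  fixes V :: "'a::t2_space \<Rightarrow> real"
  assumes "continuous_on UNIV V" "compact K" "{x. V x \<le> r} \<subseteq> K"
  shows "compact {x. V x \<le> r}"
proof -
  have "closed {x. V x \<le> r}" using assms(1) by (intro closed_Collect_le) auto
  with assms(2) have "compact (K \<inter> {x. V x \<le> r})" by (rule compact_Int_closed)
  thus ?thesis using assms(3) by (simp add: Int_absorb1)
qed

text \<open>A common interface for the class metric \<open>dist\<close> and for metrics on product
  types that induce the topology already present. Continuity and compactness refer to that
  topology.\<close>

locale proper_cost =
  fixes d :: "'a::{second_countable_topology,metric_space} \<Rightarrow> 'a \<Rightarrow> real" and p :: real
  assumes nonneg: "0 \<le> d x y" and self: "d x x = 0" and commute: "d x y = d y x"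
    and triangle: "d x z \<le> d x y + d y z"
    and continuous: "continuous_on UNIV (\<lambda>z. d (fst z) (snd z))"
    and proper: "proper_metric d"
    and p: "p > 0"
begin

abbreviation "cost \<equiv> \<lambda>x y. d x y powr p"

lemma continuous_dist_comp:
  assumes "continuous_on UNIV f" "continuous_on UNIV g"
  shows "continuous_on UNIV (\<lambda>x. d (f x) (g x))"
  using continuous_on_compose2[OF continuous continuous_on_Pair[OF assms]] by simp

lemma continuous_cost_comp:
  assumes "continuous_on UNIV f" "continuous_on UNIV g"
  shows "continuous_on UNIV (\<lambda>x. cost (f x) (g x))"
  by (rule continuous_on_powr'[OF continuous_dist_comp[OF assms] continuous_on_const]) (use nonneg p in auto)

lemma cost_measurable [measurable]: "(\<lambda>z. cost (fst z) (snd z)) \<in> borel_measurable borel"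
  by (intro borel_measurable_continuous_onI continuous_cost_comp continuous_intros)

lemma cost_section_measurable [measurable]: "cost x0 \<in> borel_measurable borel"
  by (intro borel_measurable_continuous_onI continuous_cost_comp continuous_intros)

text \<open>The sum of the two distances is at most twice the larger one. The factor 2 powr p is not
  sharp; it only has to be finite.\<close>

lemma cost_triangle: "cost x z \<le> 2 powr p * (cost x y + cost y z)"
proof -
  define m where "m = max (d x y) (d y z)"
  have m: "0 \<le> m" "d x z \<le> 2 * m" using nonneg[of x y] triangle[of x z y] by (auto simp: m_def)
  have "cost x z \<le> (2 * m) powr p" using m nonneg p by (intro powr_mono2) auto
  also have "\<dots> = 2 powr p * m powr p" using m by (simp add: powr_mult)
  also have "m powr p \<le> cost x y + cost y z" by (auto simp: m_def max_def)
  finally show ?thesis by simp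
qed

text \<open>The modulus avoids a case distinction on the sign of \<open>r\<close>: for negative
  \<open>r\<close> the premise fails.\<close>

lemma cost_le_imp: "cost x y \<le> r \<Longrightarrow> d x y \<le> \<bar>r\<bar> powr (1 / p)"
proof -
  assume "cost x y \<le> r"
  hence "cost x y powr (1 / p) \<le> \<bar>r\<bar> powr (1 / p)" using p by (intro powr_mono2) auto
  thus ?thesis using p nonneg[of x y] by (simp add: powr_powr)
qed

lemma continuous_cost_section: "continuous_on UNIV (cost x0)"
  by (intro continuous_cost_comp continuous_intros)

lemma compact_cost_sublevel: "compact {x. cost x0 x \<le> r}"
proof (rule compact_sublevel_subset[OF continuous_cost_section])
  show "compact {x. d x0 x \<le> \<bar>r\<bar> powr (1 / p)}" using proper by (simp add: proper_metric_def)
qed (auto intro: cost_le_imp)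

lemma nn_integral_cost_triangle:
  assumes "\<pi> \<in> borel_probs" "f \<in> borel_measurable \<pi>" "g \<in> borel_measurable \<pi>" "h \<in> borel_measurable \<pi>"
  shows "(\<integral>\<^sup>+z. ennreal (cost (f z) (h z)) \<partial>\<pi>)
    \<le> ennreal (2 powr p) * ((\<integral>\<^sup>+z. ennreal (cost (f z) (g z)) \<partial>\<pi>) + (\<integral>\<^sup>+z. ennreal (cost (g z) (h z)) \<partial>\<pi>))"
proof -
  note [measurable] = assms(2-4)
  have m: "(\<lambda>z. cost (u z) (v z)) \<in> borel_measurable \<pi>"
    if "u \<in> borel_measurable \<pi>" "v \<in> borel_measurable \<pi>" for u v
    using measurable_compose[OF borel_measurable_Pair[OF that] cost_measurable] by simp
  have "(\<integral>\<^sup>+z. ennreal (cost (f z) (h z)) \<partial>\<pi>)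
    \<le> (\<integral>\<^sup>+z. ennreal (2 powr p) * (ennreal (cost (f z) (g z)) + ennreal (cost (g z) (h z))) \<partial>\<pi>)"
    by (intro nn_integral_mono) (simp flip: ennreal_plus ennreal_mult' add: ennreal_leI cost_triangle)
  also have "\<dots> = ennreal (2 powr p) * ((\<integral>\<^sup>+z. ennreal (cost (f z) (g z)) \<partial>\<pi>) + (\<integral>\<^sup>+z. ennreal (cost (g z) (h z)) \<partial>\<pi>))"
    using m[OF assms(2,3)] m[OF assms(3,4)] by (simp add: nn_integral_cmult nn_integral_add)
  finally show ?thesis .
qed

text \<open>Membership provides a finite moment at one unspecified point; the triangle inequality
  through that point moves it to any \<open>x0\<close>.\<close>

lemma finite_moment_at:
  assumes "\<mu> \<in> finite_moment_probs d p"
  shows "(\<integral>\<^sup>+x. ennreal (cost x0 x) \<partial>\<mu>) < \<infinity>"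
proof -
  obtain x1 where \<mu>: "\<mu> \<in> borel_probs" and x1: "(\<integral>\<^sup>+x. ennreal (cost x1 x) \<partial>\<mu>) < \<infinity>"
    using assms by (auto simp: finite_moment_probs_def)
  interpret prob_space \<mu> using \<mu> by (simp add: borel_probs_iff)
  have [measurable_cong]: "sets \<mu> = sets borel" using \<mu> by (simp add: borel_probs_iff)
  have "(\<integral>\<^sup>+x. ennreal (cost x0 x) \<partial>\<mu>)
      \<le> ennreal (2 powr p) * ((\<integral>\<^sup>+x. ennreal (cost x0 x1) \<partial>\<mu>) + (\<integral>\<^sup>+x. ennreal (cost x1 x) \<partial>\<mu>))"
    by (rule nn_integral_cost_triangle[OF \<mu>]) auto
  also have "\<dots> < \<infinity>" using x1 by (simp add: ennreal_mult_less_top emeasure_space_1)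
  finally show ?thesis .
qed

text \<open>A coupling of cost at most \<delta> + 1 carries the moment of \<open>\<mu>\<close> over
  to \<open>\<nu>\<close> by the triangle inequality. The slack 1 is arbitrary; what counts is that
  \<open>B\<close> does not depend on \<open>\<nu>\<close>, so that it serves the whole
  ball.\<close>

lemma moment_bound:
  assumes \<mu>: "\<mu> \<in> finite_moment_probs d p" and "\<delta> \<ge> 0"
  obtains B where "B \<ge> 0" "\<And>\<nu>. transport_cost cost \<mu> \<nu> \<le> ennreal \<delta> \<Longrightarrow> (\<integral>\<^sup>+x. ennreal (cost x0 x) \<partial>\<nu>) \<le> ennreal B"
proof -
  define A where "A = ennreal (2 powr p) * ((\<integral>\<^sup>+x. ennreal (cost x0 x) \<partial>\<mu>) + ennreal (\<delta> + 1))"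
  have A: "A < \<infinity>" using finite_moment_at[OF \<mu>, of x0] by (simp add: A_def ennreal_mult_less_top)
  have "(\<integral>\<^sup>+x. ennreal (cost x0 x) \<partial>\<nu>) \<le> A" if \<nu>: "transport_cost cost \<mu> \<nu> \<le> ennreal \<delta>" for \<nu>
  proof -
    obtain \<pi> where \<pi>: "\<pi> \<in> couplings \<mu> \<nu>" "(\<integral>\<^sup>+z. ennreal (cost (fst z) (snd z)) \<partial>\<pi>) \<le> ennreal (\<delta> + 1)"
      using transport_cost_le_obtains[OF \<nu> \<open>\<delta> \<ge> 0\<close>, of 1] by auto
    have \<pi>b: "\<pi> \<in> borel_probs" and m: "distr \<pi> borel fst = \<mu>" "distr \<pi> borel snd = \<nu>"
      using \<pi>(1) by (auto simp: couplings_def)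
    have [measurable_cong]: "sets \<pi> = sets borel" using \<pi>b by (simp add: borel_probs_iff)
    have "(\<integral>\<^sup>+x. ennreal (cost x0 x) \<partial>\<nu>) = (\<integral>\<^sup>+z. ennreal (cost x0 (snd z)) \<partial>\<pi>)"
      unfolding m(2)[symmetric] by (rule nn_integral_distr) measurable
    also have "\<dots> \<le> ennreal (2 powr p) * ((\<integral>\<^sup>+z. ennreal (cost x0 (fst z)) \<partial>\<pi>) + (\<integral>\<^sup>+z. ennreal (cost (fst z) (snd z)) \<partial>\<pi>))"
      by (rule nn_integral_cost_triangle[OF \<pi>b]) measurable
    also have "(\<integral>\<^sup>+z. ennreal (cost x0 (fst z)) \<partial>\<pi>) = (\<integral>\<^sup>+x. ennreal (cost x0 x) \<partial>\<mu>)"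
      unfolding m(1)[symmetric] by (rule nn_integral_distr[symmetric]) measurable
    finally show ?thesis
      using \<pi>(2) unfolding A_def by (auto elim!: order_trans intro!: mult_left_mono add_mono)
  qed
  thus ?thesis using that[of "enn2real A"] A by (simp add: ennreal_enn2real)
qed

text \<open>Couplings with slack 1/(n+1) have marginals with bounded moments, so a subsequence has
  an almost surely convergent representation on a new probability space. The law of the limit is
  shown to couple \<open>\<mu>\<close> with the law of \<open>Y\<close> by comparing laws, as
  \<open>Y\<close> lives on another space; Fatou's lemma bounds its cost.\<close>

lemma transport_cost_limit_le:
  assumes \<mu>: "\<mu> \<in> finite_moment_probs d p" and "\<delta> \<ge> 0"
    and X: "prob_space \<Omega>" "\<And>n. X n \<in> borel_measurable \<Omega>" "Y \<in> borel_measurable \<Omega>"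
      "AE \<omega> in \<Omega>. (\<lambda>n. X n \<omega>) \<longlonglongrightarrow> Y \<omega>"
    and le: "\<And>n. transport_cost cost \<mu> (distr \<Omega> borel (X n)) \<le> ennreal \<delta>"
  shows "transport_cost cost \<mu> (distr \<Omega> borel Y) \<le> ennreal \<delta>"
proof -
  define x0 where "x0 = (undefined :: 'a)"
  have \<mu>b: "\<mu> \<in> borel_probs" using \<mu> by (simp add: finite_moment_probs_def)
  interpret \<mu>: prob_space \<mu> using \<mu>b by (simp add: borel_probs_iff)
  have \<mu>s[measurable_cong]: "sets \<mu> = sets borel" using \<mu>b by (simp add: borel_probs_iff)
  have "\<exists>\<pi>. \<pi> \<in> couplings \<mu> (distr \<Omega> borel (X n)) \<and>
      (\<integral>\<^sup>+z. ennreal (cost (fst z) (snd z)) \<partial>\<pi>) \<le> ennreal (\<delta> + inverse (Suc n))" for n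
    using transport_cost_le_obtains[OF le \<open>\<delta> \<ge> 0\<close>, of "inverse (Suc n)" n] by (metis inverse_positive_iff_positive of_nat_0_less_iff zero_less_Suc)
  then obtain \<pi> where \<pi>: "\<And>n. \<pi> n \<in> couplings \<mu> (distr \<Omega> borel (X n))"
    "\<And>n. (\<integral>\<^sup>+z. ennreal (cost (fst z) (snd z)) \<partial>\<pi> n) \<le> ennreal (\<delta> + inverse (Suc n))" by metis
  have \<pi>b: "\<pi> n \<in> borel_probs" and m1: "distr (\<pi> n) borel fst = \<mu>"
    and m2: "distr (\<pi> n) borel snd = distr \<Omega> borel (X n)" for n
    using \<pi>(1)[of n] by (auto simp: couplings_def)
  have [measurable_cong]: "sets (\<pi> n) = sets borel" for n using \<pi>b by (simp add: borel_probs_iff)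
  define V where "V z = cost x0 (fst z) + cost x0 (snd z)" for z
  have Vc: "continuous_on UNIV V"
    unfolding V_def by (intro continuous_on_add continuous_cost_comp continuous_intros)
  have V0: "0 \<le> V z" for z by (simp add: V_def)
  have Vk: "compact {z. V z \<le> r}" for r
  proof (rule compact_sublevel_subset[OF Vc])
    let ?K = "{y. d x0 y \<le> \<bar>r\<bar> powr (1 / p)}"
    show "compact (?K \<times> ?K)" using proper by (intro compact_Times) (auto simp: proper_metric_def)
    show "{z. V z \<le> r} \<subseteq> ?K \<times> ?K"
    proof
      fix z assume "z \<in> {z. V z \<le> r}"
      hence "cost x0 (fst z) \<le> r" "cost x0 (snd z) \<le> r"
        using powr_ge_zero[of "d x0 (fst z)" p] powr_ge_zero[of "d x0 (snd z)" p] unfolding V_def mem_Collect_eq by linarith+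
      thus "z \<in> ?K \<times> ?K" by (simp add: mem_Times_iff cost_le_imp)
    qed
  qed
  obtain B where B: "B \<ge> 0" "\<And>\<nu>. transport_cost cost \<mu> \<nu> \<le> ennreal \<delta> \<Longrightarrow> (\<integral>\<^sup>+x. ennreal (cost x0 x) \<partial>\<nu>) \<le> ennreal B"
    using moment_bound[OF \<mu> \<open>\<delta> \<ge> 0\<close>] by blast
  define A where "A = enn2real (\<integral>\<^sup>+x. ennreal (cost x0 x) \<partial>\<mu>)"
  have A: "A \<ge> 0" "(\<integral>\<^sup>+x. ennreal (cost x0 x) \<partial>\<mu>) = ennreal A"
    using finite_moment_at[OF \<mu>, of x0] by (auto simp: A_def ennreal_enn2real)
  have bound: "(\<integral>\<^sup>+z. ennreal (V z) \<partial>\<pi> n) \<le> ennreal (A + B)" for n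
  proof -
    have "(\<integral>\<^sup>+z. ennreal (V z) \<partial>\<pi> n) = (\<integral>\<^sup>+z. ennreal (cost x0 (fst z)) + ennreal (cost x0 (snd z)) \<partial>\<pi> n)"
      by (simp add: V_def)
    also have "\<dots> = (\<integral>\<^sup>+z. ennreal (cost x0 (fst z)) \<partial>\<pi> n) + (\<integral>\<^sup>+z. ennreal (cost x0 (snd z)) \<partial>\<pi> n)"
      by (rule nn_integral_add) measurable
    also have "(\<integral>\<^sup>+z. ennreal (cost x0 (fst z)) \<partial>\<pi> n) = (\<integral>\<^sup>+x. ennreal (cost x0 x) \<partial>\<mu>)"
      unfolding m1[of n, symmetric] by (rule nn_integral_distr[symmetric]) measurable
    also have "(\<integral>\<^sup>+z. ennreal (cost x0 (snd z)) \<partial>\<pi> n) = (\<integral>\<^sup>+x. ennreal (cost x0 x) \<partial>distr (\<pi> n) borel snd)"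
      by (rule nn_integral_distr[symmetric]) measurable
    also have "(\<integral>\<^sup>+x. ennreal (cost x0 x) \<partial>\<mu>) + \<dots> \<le> ennreal A + ennreal B"
      unfolding m2 A(2) by (intro add_left_mono B(2) le)
    finally show ?thesis using A(1) B(1) by simp
  qed
  obtain r and \<Omega>' :: "real measure" and Z W where r: "strict_mono r" and Z: "prob_space \<Omega>'"
    "\<forall>n. Z n \<in> borel_measurable \<Omega>'" "\<forall>n. distr \<Omega>' borel (Z n) = \<pi> (r n)"
    "W \<in> borel_measurable \<Omega>'" "AE \<omega> in \<Omega>'. (\<lambda>n. Z n \<omega>) \<longlonglongrightarrow> W \<omega>"
    using prokhorov_skorohod[where P = \<pi>, OF Vc Vk V0 \<pi>b bound] .
  note Z = Z[rule_format]
  interpret \<Omega>': prob_space \<Omega>' by (rule Z)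
  note [measurable] = Z(2,4)
  have comp: "distr \<Omega>' borel (\<lambda>\<omega>. q (Z n \<omega>)) = distr (\<pi> (r n)) borel q"
    if "q \<in> borel_measurable borel" for n and q :: "'a \<times> 'a \<Rightarrow> 'a"
    unfolding Z(3)[symmetric] using that Z(2) by (subst distr_distr) (auto simp: o_def)
  \<comment> \<open>Every coupling has first marginal \<open>\<mu>\<close>, so the comparison
    sequence is constantly the identity on \<open>\<mu>\<close>.\<close>
  have "distr \<Omega>' borel (\<lambda>\<omega>. fst (W \<omega>)) = distr \<mu> borel (\<lambda>x. x)"
  proof (rule limit_law_unique[OF Z(1) _ _ _ \<mu>.prob_space_axioms, where X' = "\<lambda>_ x. x"])
    show "AE \<omega> in \<Omega>'. (\<lambda>n. fst (Z n \<omega>)) \<longlonglongrightarrow> fst (W \<omega>)"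
      using Z(5) by eventually_elim (rule tendsto_fst)
    show "distr \<Omega>' borel (\<lambda>\<omega>. fst (Z n \<omega>)) = distr \<mu> borel (\<lambda>x. x)" for n
      by (simp add: comp m1 distr_id2 \<mu>s)
  qed auto
  also have "\<dots> = \<mu>" by (rule distr_id2) (simp add: \<mu>s)
  finally have 1: "distr \<Omega>' borel (\<lambda>\<omega>. fst (W \<omega>)) = \<mu>" .
  \<comment> \<open>The second coordinates have the same laws as the subsequence
    \<open>X (r n)\<close>, whose limit on \<open>\<Omega>\<close> is \<open>Y\<close>.\<close>
  have 2: "distr \<Omega>' borel (\<lambda>\<omega>. snd (W \<omega>)) = distr \<Omega> borel Y"
  proof (rule limit_law_unique[OF Z(1) _ _ _ X(1) _ X(3)])
    show "AE \<omega> in \<Omega>'. (\<lambda>n. snd (Z n \<omega>)) \<longlonglongrightarrow> snd (W \<omega>)"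
      using Z(5) by eventually_elim (rule tendsto_snd)
    show "AE \<omega> in \<Omega>. (\<lambda>n. X (r n) \<omega>) \<longlonglongrightarrow> Y \<omega>"
      using X(4) by eventually_elim (use LIMSEQ_subseq_LIMSEQ[OF _ r] in \<open>auto simp: o_def\<close>)
    show "distr \<Omega>' borel (\<lambda>\<omega>. snd (Z n \<omega>)) = distr \<Omega> borel (X (r n))" for n
      by (simp add: comp m2)
  qed (use X(2) in auto)
  have "distr \<Omega>' borel W \<in> couplings \<mu> (distr \<Omega> borel Y)"
    unfolding couplings_def using 1 2
    by (auto simp: borel_probs_iff distr_distr o_def intro!: \<Omega>'.prob_space_distr)
  hence "transport_cost cost \<mu> (distr \<Omega> borel Y) \<le> (\<integral>\<^sup>+z. ennreal (cost (fst z) (snd z)) \<partial>distr \<Omega>' borel W)"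
    unfolding transport_cost_def by (rule INF_lower)
  also have "\<dots> = (\<integral>\<^sup>+\<omega>. ennreal (cost (fst (W \<omega>)) (snd (W \<omega>))) \<partial>\<Omega>')"
    by (rule nn_integral_distr) measurable
  also have "\<dots> \<le> ennreal \<delta>"
  proof (rule nn_integral_limit_law_le[OF Z(2,4,5), of "\<lambda>z. cost (fst z) (snd z)" "\<lambda>n. ennreal (\<delta> + inverse (Suc (r n)))"])
    show "continuous_on UNIV (\<lambda>z. cost (fst z) (snd z))"
      by (intro continuous_cost_comp continuous_intros)
    show "(\<integral>\<^sup>+\<omega>. ennreal (cost (fst (Z n \<omega>)) (snd (Z n \<omega>))) \<partial>\<Omega>') \<le> ennreal (\<delta> + inverse (Suc (r n)))" for n
    proof -
      have "(\<integral>\<^sup>+\<omega>. ennreal (cost (fst (Z n \<omega>)) (snd (Z n \<omega>))) \<partial>\<Omega>') = (\<integral>\<^sup>+z. ennreal (cost (fst z) (snd z)) \<partial>\<pi> (r n))"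
        unfolding Z(3)[symmetric] by (rule nn_integral_distr[symmetric]) measurable
      thus ?thesis using \<pi>(2)[of "r n"] by simp
    qed
    have "(\<lambda>n. \<delta> + inverse (real (Suc (r n)))) \<longlonglongrightarrow> \<delta> + 0"
      using LIMSEQ_subseq_LIMSEQ[OF LIMSEQ_inverse_real_of_nat r] by (intro tendsto_intros) (simp add: o_def)
    thus "(\<lambda>n. ennreal (\<delta> + inverse (Suc (r n)))) \<longlonglongrightarrow> ennreal \<delta>"
      by (intro tendsto_ennrealI) simp
  qed
  finally show ?thesis .
qed

end

section \<open>Growth comparison, admissible metrics and the common theorem\<close>

lemma powr_lower_order:
  fixes p q e :: real
  assumes "0 < q" "q < p" "e > 0"
  obtains R where "R \<ge> 0" "\<And>a. a \<ge> 0 \<Longrightarrow> a powr q \<le> R + e * a powr p"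
proof -
  \<comment> \<open>\<open>T\<close> solves T powr q = e * T powr p: up to \<open>T\<close> the
    constant T powr q suffices, beyond it the term e * a powr p dominates.\<close>
  define T where "T = (1 / e) powr (1 / (p - q))"
  have Tpos: "T > 0" using assms by (simp add: T_def)
  have "T powr (p - q) = 1 / e" using assms by (simp add: T_def powr_powr)
  have "a powr q \<le> T powr q + e * a powr p" if a: "a \<ge> 0" for a
  proof (cases "a \<le> T")
    case True
    hence "a powr q \<le> T powr q" using a assms by (intro powr_mono2) auto
    thus ?thesis using assms by (simp add: add_increasing2)
  next
    case False
    have "1 / e \<le> a powr (p - q)"
      unfolding \<open>T powr (p - q) = 1 / e\<close>[symmetric] using False Tpos assms by (intro powr_mono2) auto
    hence "1 \<le> e * a powr (p - q)" using assms by (simp add: field_simps)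
    hence "1 * a powr q \<le> (e * a powr (p - q)) * a powr q" by (intro mult_right_mono) auto
    also have "\<dots> = e * a powr p" by (simp add: mult.assoc flip: powr_add)
    finally show ?thesis by (simp add: add_increasing)
  qed
  with Tpos show ?thesis by (intro that[of "T powr q"]) auto
qed

lemma proper_cost_dist:
  assumes "proper_metric (dist :: 'a::{second_countable_topology,metric_space} \<Rightarrow> 'a \<Rightarrow> real)" "p > 0"
  shows "proper_cost (dist :: 'a \<Rightarrow> 'a \<Rightarrow> real) p"
proof
  show "continuous_on UNIV (\<lambda>z. dist (fst z) (snd z :: 'a))" by (intro continuous_intros)
  show "dist x z \<le> dist x y + dist y z" for x y z :: 'a by (rule dist_triangle)
qed (use assms in \<open>auto simp: dist_commute\<close>)

text \<open>Equality of the topologies turns convergence in the type into vanishing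
  \<open>d\<close>-distance; joint continuity then follows from |d x y - d a b| <= d x a + d y
  b.\<close>

lemma proper_cost_polish_metric:
  fixes d :: "'a::{second_countable_topology,metric_space} \<Rightarrow> 'a \<Rightarrow> real"
  assumes "polish_metric d" "proper_metric d" "p > 0"
  shows "proper_cost d p"
proof -
  interpret Metric_space UNIV d using assms(1) by (simp add: polish_metric_def)
  have top: "mtopology = euclidean" using assms(1) by (simp add: polish_metric_def)
  have null: "(\<lambda>n. d (x n) a) \<longlonglongrightarrow> 0" if "x \<longlonglongrightarrow> a" for x and a :: 'a
    using that limitin_metric_dist_null[of x a sequentially] by (simp add: top)
  show ?thesis
  proof
    show "continuous_on UNIV (\<lambda>z. d (fst z) (snd z))"
    proof (rule continuous_on_sequentiallyI)
      fix u :: "nat \<Rightarrow> 'a \<times> 'a" and a assume u: "u \<longlonglongrightarrow> a"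
      let ?D = "\<lambda>n. d (fst (u n)) (fst a) + d (snd (u n)) (snd a)"
      have lim: "?D \<longlonglongrightarrow> 0"
        using tendsto_add[OF null[OF tendsto_fst[OF u]] null[OF tendsto_snd[OF u]]] by simp
      have "norm (d (fst (u n)) (snd (u n)) - d (fst a) (snd a)) \<le> ?D n" for n
        using triangle[of "fst (u n)" "fst a" "snd (u n)"] triangle[of "fst a" "snd a" "snd (u n)"]
          triangle[of "fst a" "fst (u n)" "snd a"] triangle[of "fst (u n)" "snd (u n)" "snd a"]
          commute[of "snd (u n)" "snd a"] commute[of "fst (u n)" "fst a"] by simp
      hence "(\<lambda>n. d (fst (u n)) (snd (u n)) - d (fst a) (snd a)) \<longlonglongrightarrow> 0"
        by (intro Lim_null_comparison[OF _ lim] always_eventually) auto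
      thus "(\<lambda>n. d (fst (u n)) (snd (u n))) \<longlonglongrightarrow> d (fst a) (snd a)"
        by (rule LIM_zero_cancel)
    qed
    show "d x z \<le> d x y + d y z" for x y z by (rule triangle) simp_all
  qed (use assms(2,3) commute in auto)
qed

text \<open>The hypothesis on preimages of compact sets makes (q1, q2) a proper map, which turns
  balls in the two target spaces into compact sublevel sets of \<open>V\<close>. Nonemptiness is
  left as a hypothesis because its proof depends on how the two images overlap.\<close>

theorem integral_values_transport_ball:
  fixes q1 :: "'c::{second_countable_topology,metric_space} \<Rightarrow> 'a::{second_countable_topology,metric_space}"
    and q2 :: "'c \<Rightarrow> 'b::{second_countable_topology,metric_space}"
    and d1 d2 \<mu>1 \<mu>2 and p1 p2 \<delta>1 \<delta>2 :: real and h :: "'c \<Rightarrow> real"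
  defines "\<Sigma> \<equiv> {\<gamma> \<in> borel_probs.
        transport_cost (\<lambda>s t. d1 s t powr p1) \<mu>1 (distr \<gamma> borel q1) \<le> ennreal \<delta>1 \<and>
        transport_cost (\<lambda>s t. d2 s t powr p2) \<mu>2 (distr \<gamma> borel q2) \<le> ennreal \<delta>2}"
  assumes d: "proper_cost d1 p1" "proper_cost d2 p2"
    and \<mu>: "\<mu>1 \<in> finite_moment_probs d1 p1" "\<mu>2 \<in> finite_moment_probs d2 p2"
    and \<delta>: "\<delta>1 \<ge> 0" "\<delta>2 \<ge> 0"
    and q: "continuous_on UNIV q1" "continuous_on UNIV q2"
      "\<And>K1 K2. compact K1 \<Longrightarrow> compact K2 \<Longrightarrow> compact {c. q1 c \<in> K1 \<and> q2 c \<in> K2}"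
    and h: "continuous_on UNIV h"
    and growth: "M > 0" "0 < p1'" "p1' < p1" "0 < p2'" "p2' < p2"
      "\<And>c. \<bar>h c\<bar> \<le> M * (1 + d1 s1 (q1 c) powr p1' + d2 s2 (q2 c) powr p2')"
    and nonempty: "\<Sigma> \<noteq> {}"
  shows "(\<forall>\<gamma>\<in>\<Sigma>. integrable \<gamma> h) \<and>
        (\<exists>\<gamma>min\<in>\<Sigma>. \<exists>\<gamma>max\<in>\<Sigma>.
           (\<forall>\<gamma>\<in>\<Sigma>. (\<integral>s. h s \<partial>\<gamma>min) \<le> (\<integral>s. h s \<partial>\<gamma>) \<and> (\<integral>s. h s \<partial>\<gamma>) \<le> (\<integral>s. h s \<partial>\<gamma>max)) \<and>
           integral_values h \<Sigma> = {(\<integral>s. h s \<partial>\<gamma>min) .. (\<integral>s. h s \<partial>\<gamma>max)})"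
proof -
  interpret d1: proper_cost d1 p1 by (rule d)
  interpret d2: proper_cost d2 p2 by (rule d)
  have qm[measurable]: "q1 \<in> borel_measurable borel" "q2 \<in> borel_measurable borel"
    and hm[measurable]: "h \<in> borel_measurable borel"
    by (auto intro: borel_measurable_continuous_onI q h)
  \<comment> \<open>Centred at the base points of the growth bound, so that \<open>h\<close> and
    \<open>V\<close> are compared through powers of the same distances.\<close>
  define V where "V c = d1.cost s1 (q1 c) + d2.cost s2 (q2 c)" for c
  have Vc: "continuous_on UNIV V"
    unfolding V_def by (intro continuous_on_add d1.continuous_cost_comp d2.continuous_cost_comp continuous_on_const q)
  hence Vm[measurable]: "V \<in> borel_measurable borel" by (rule borel_measurable_continuous_onI)
  have V0: "0 \<le> V c" for c by (simp add: V_def)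
  have Vk: "compact {c. V c \<le> r}" for r
  proof (rule compact_sublevel_subset[OF Vc])
    let ?K1 = "{y. d1 s1 y \<le> \<bar>r\<bar> powr (1 / p1)}" and ?K2 = "{y. d2 s2 y \<le> \<bar>r\<bar> powr (1 / p2)}"
    show "compact {c. q1 c \<in> ?K1 \<and> q2 c \<in> ?K2}"
      using d1.proper d2.proper by (intro q(3)) (auto simp: proper_metric_def)
    show "{c. V c \<le> r} \<subseteq> {c. q1 c \<in> ?K1 \<and> q2 c \<in> ?K2}"
    proof
      fix c assume "c \<in> {c. V c \<le> r}"
      hence "d1.cost s1 (q1 c) \<le> r" "d2.cost s2 (q2 c) \<le> r"
        using powr_ge_zero[of "d1 s1 (q1 c)" p1] powr_ge_zero[of "d2 s2 (q2 c)" p2]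
        unfolding V_def mem_Collect_eq by linarith+
      thus "c \<in> {c. q1 c \<in> ?K1 \<and> q2 c \<in> ?K2}" by (simp add: d1.cost_le_imp d2.cost_le_imp)
    qed
  qed
  have growth': "\<exists>R. \<forall>c. \<bar>h c\<bar> \<le> R + e * V c" if "e > 0" for e
  proof -
    have eM: "e / M > 0" using that growth(1) by simp
    obtain R1 where R1: "\<And>a. a \<ge> 0 \<Longrightarrow> a powr p1' \<le> R1 + e / M * a powr p1"
      using powr_lower_order[OF growth(2,3) eM] by blast
    obtain R2 where R2: "\<And>a. a \<ge> 0 \<Longrightarrow> a powr p2' \<le> R2 + e / M * a powr p2"
      using powr_lower_order[OF growth(4,5) eM] by blast
    show ?thesis
    proof (intro exI[of _ "M * (1 + R1 + R2)"] allI)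
      fix c
      have "\<bar>h c\<bar> \<le> M * (1 + d1 s1 (q1 c) powr p1' + d2 s2 (q2 c) powr p2')" by (rule growth)
      also have "\<dots> \<le> M * (1 + (R1 + e / M * d1.cost s1 (q1 c)) + (R2 + e / M * d2.cost s2 (q2 c)))"
        using growth(1) by (intro mult_left_mono add_mono order.refl R1 R2 d1.nonneg d2.nonneg) auto
      also have "\<dots> = M * (1 + R1 + R2) + e * V c"
        using growth(1) by (simp add: V_def field_simps)
      finally show "\<bar>h c\<bar> \<le> M * (1 + R1 + R2) + e * V c" .
    qed
  qed
  have \<Sigma>D: "\<gamma> \<in> borel_probs" "transport_cost d1.cost \<mu>1 (distr \<gamma> borel q1) \<le> ennreal \<delta>1"
    "transport_cost d2.cost \<mu>2 (distr \<gamma> borel q2) \<le> ennreal \<delta>2" if "\<gamma> \<in> \<Sigma>" for \<gamma>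
    using that by (auto simp: \<Sigma>_def)
  obtain B1 where B1: "B1 \<ge> 0" "\<And>\<nu>. transport_cost d1.cost \<mu>1 \<nu> \<le> ennreal \<delta>1 \<Longrightarrow> (\<integral>\<^sup>+x. ennreal (d1.cost s1 x) \<partial>\<nu>) \<le> ennreal B1"
    using d1.moment_bound[OF \<mu>(1) \<delta>(1)] by blast
  obtain B2 where B2: "B2 \<ge> 0" "\<And>\<nu>. transport_cost d2.cost \<mu>2 \<nu> \<le> ennreal \<delta>2 \<Longrightarrow> (\<integral>\<^sup>+x. ennreal (d2.cost s2 x) \<partial>\<nu>) \<le> ennreal B2"
    using d2.moment_bound[OF \<mu>(2) \<delta>(2)] by blast
  have bound: "(\<integral>\<^sup>+c. ennreal (V c) \<partial>\<gamma>) \<le> ennreal (B1 + B2)" if \<gamma>: "\<gamma> \<in> \<Sigma>" for \<gamma>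
  proof -
    have [measurable_cong]: "sets \<gamma> = sets borel" using \<Sigma>D(1)[OF \<gamma>] by (simp add: borel_probs_iff)
    have "(\<integral>\<^sup>+c. ennreal (V c) \<partial>\<gamma>) = (\<integral>\<^sup>+c. ennreal (d1.cost s1 (q1 c)) + ennreal (d2.cost s2 (q2 c)) \<partial>\<gamma>)"
      by (simp add: V_def)
    also have "\<dots> = (\<integral>\<^sup>+c. ennreal (d1.cost s1 (q1 c)) \<partial>\<gamma>) + (\<integral>\<^sup>+c. ennreal (d2.cost s2 (q2 c)) \<partial>\<gamma>)"
      by (rule nn_integral_add) measurable
    also have "(\<integral>\<^sup>+c. ennreal (d1.cost s1 (q1 c)) \<partial>\<gamma>) = (\<integral>\<^sup>+x. ennreal (d1.cost s1 x) \<partial>distr \<gamma> borel q1)"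
      by (rule nn_integral_distr[symmetric]) measurable
    also have "(\<integral>\<^sup>+c. ennreal (d2.cost s2 (q2 c)) \<partial>\<gamma>) = (\<integral>\<^sup>+x. ennreal (d2.cost s2 x) \<partial>distr \<gamma> borel q2)"
      by (rule nn_integral_distr[symmetric]) measurable
    also have "(\<integral>\<^sup>+x. ennreal (d1.cost s1 x) \<partial>distr \<gamma> borel q1) + \<dots> \<le> ennreal B1 + ennreal B2"
      by (intro add_mono B1(2) B2(2) \<Sigma>D \<gamma>)
    finally show ?thesis using B1(1) B2(1) by simp
  qed
  have int: "integrable \<gamma> h" if \<gamma>: "\<gamma> \<in> \<Sigma>" for \<gamma>
  proof -
    interpret prob_space \<gamma> using \<Sigma>D(1)[OF \<gamma>] by (simp add: borel_probs_iff)
    have [measurable_cong]: "sets \<gamma> = sets borel" using \<Sigma>D(1)[OF \<gamma>] by (simp add: borel_probs_iff)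
    obtain R where R: "\<And>c. \<bar>h c\<bar> \<le> R + V c" using growth'[of 1] by auto
    have "integrable \<gamma> V"
      by (rule integrableI_nonneg) (use V0 bound[OF \<gamma>] in \<open>auto simp: le_less_trans\<close>)
    hence "integrable \<gamma> (\<lambda>c. R + V c)" by simp
    thus ?thesis
      by (rule Bochner_Integration.integrable_bound) (auto intro: order_trans[OF R abs_ge_self])
  qed
  let ?S = "integral_values h \<Sigma>"
  have mix: "mixture t \<gamma> \<gamma>' \<in> \<Sigma>" if "\<gamma> \<in> \<Sigma>" "\<gamma>' \<in> \<Sigma>" "0 \<le> t" "t \<le> 1" for \<gamma> \<gamma>' t
    unfolding \<Sigma>_def
    using that \<Sigma>D \<delta> d1.cost_measurable d2.cost_measurable
    by (auto simp: mixture_borel_probs distr_mixture qm intro!: transport_cost_mixture_le)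
  have "convex ?S"
  proof (rule convexI)
    fix x y u v :: real assume xy: "x \<in> ?S" "y \<in> ?S" and uv: "0 \<le> u" "0 \<le> v" "u + v = 1"
    obtain \<gamma> \<gamma>' where \<gamma>: "\<gamma> \<in> \<Sigma>" "x = (\<integral>s. h s \<partial>\<gamma>)" and \<gamma>': "\<gamma>' \<in> \<Sigma>" "y = (\<integral>s. h s \<partial>\<gamma>')"
      using xy by (auto simp: integral_values_def)
    have v: "v = 1 - u" "u \<le> 1" using uv by auto
    have "(\<integral>s. h s \<partial>mixture u \<gamma> \<gamma>') = u *\<^sub>R x + v *\<^sub>R y"
      using integral_mixture(2)[OF \<Sigma>D(1)[OF \<gamma>(1)] \<Sigma>D(1)[OF \<gamma>'(1)] int[OF \<gamma>(1)] int[OF \<gamma>'(1)] uv(1) v(2) hm]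
      by (simp add: \<gamma>(2) \<gamma>'(2) v(1))
    thus "u *\<^sub>R x + v *\<^sub>R y \<in> ?S"
      using mix[OF \<gamma>(1) \<gamma>'(1) uv(1) v(2)] by (auto simp: integral_values_def intro!: exI[of _ "mixture u \<gamma> \<gamma>'"])
  qed
  moreover have "compact ?S"
    unfolding compact_eq_seq_compact_metric seq_compact_def
  proof (intro allI impI)
    fix f :: "nat \<Rightarrow> real" assume "\<forall>n. f n \<in> ?S"
    hence "\<forall>n. \<exists>\<gamma>. \<gamma> \<in> \<Sigma> \<and> f n = (\<integral>s. h s \<partial>\<gamma>)" by (auto simp: integral_values_def)
    then obtain G where G: "\<And>n. G n \<in> \<Sigma>" "\<And>n. f n = (\<integral>s. h s \<partial>G n)" by metis
    obtain r and \<Omega> :: "real measure" and X Y where r: "strict_mono r" and X: "prob_space \<Omega>"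
      "\<forall>n. X n \<in> borel_measurable \<Omega>" "\<forall>n. distr \<Omega> borel (X n) = G (r n)"
      "Y \<in> borel_measurable \<Omega>" "AE \<omega> in \<Omega>. (\<lambda>n. X n \<omega>) \<longlonglongrightarrow> Y \<omega>"
      using prokhorov_skorohod[where P = G, OF Vc Vk V0 \<Sigma>D(1)[OF G(1)] bound[OF G(1)]] .
    note X = X[rule_format]
    interpret prob_space \<Omega> by (rule X)
    note [measurable] = X(2,4)
    have comp: "distr \<Omega> borel (\<lambda>\<omega>. q (X n \<omega>)) = distr (G (r n)) borel q"
      if "q \<in> borel_measurable borel" for n and q :: "'c \<Rightarrow> 'd::topological_space"
      unfolding X(3)[symmetric] using that X(2) by (subst distr_distr) (auto simp: o_def)
    have compY: "distr (distr \<Omega> borel Y) borel q = distr \<Omega> borel (\<lambda>\<omega>. q (Y \<omega>))"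
      if "q \<in> borel_measurable borel" for q :: "'c \<Rightarrow> 'd::topological_space"
      using that X(4) by (subst distr_distr) (auto simp: o_def)
    have Yp: "distr \<Omega> borel Y \<in> borel_probs" by (auto simp: borel_probs_iff intro!: prob_space_distr)
    have 1: "transport_cost d1.cost \<mu>1 (distr \<Omega> borel (\<lambda>\<omega>. q1 (Y \<omega>))) \<le> ennreal \<delta>1"
    proof (rule d1.transport_cost_limit_le[OF \<mu>(1) \<delta>(1) X(1), where X = "\<lambda>n \<omega>. q1 (X n \<omega>)"])
      show "AE \<omega> in \<Omega>. (\<lambda>n. q1 (X n \<omega>)) \<longlonglongrightarrow> q1 (Y \<omega>)"
        using X(5) by eventually_elim (auto intro: continuous_on_tendsto_compose[OF q(1)])
      show "transport_cost d1.cost \<mu>1 (distr \<Omega> borel (\<lambda>\<omega>. q1 (X n \<omega>))) \<le> ennreal \<delta>1" for n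
        unfolding comp[OF qm(1)] by (rule \<Sigma>D G)+
    qed measurable
    have 2: "transport_cost d2.cost \<mu>2 (distr \<Omega> borel (\<lambda>\<omega>. q2 (Y \<omega>))) \<le> ennreal \<delta>2"
    proof (rule d2.transport_cost_limit_le[OF \<mu>(2) \<delta>(2) X(1), where X = "\<lambda>n \<omega>. q2 (X n \<omega>)"])
      show "AE \<omega> in \<Omega>. (\<lambda>n. q2 (X n \<omega>)) \<longlonglongrightarrow> q2 (Y \<omega>)"
        using X(5) by eventually_elim (auto intro: continuous_on_tendsto_compose[OF q(2)])
      show "transport_cost d2.cost \<mu>2 (distr \<Omega> borel (\<lambda>\<omega>. q2 (X n \<omega>))) \<le> ennreal \<delta>2" for n
        unfolding comp[OF qm(2)] by (rule \<Sigma>D G)+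
    qed measurable
    have Y\<Sigma>: "distr \<Omega> borel Y \<in> \<Sigma>"
      unfolding \<Sigma>_def using Yp 1 2 by (simp add: compY qm)
    have VX: "(\<integral>\<^sup>+\<omega>. ennreal (V (X n \<omega>)) \<partial>\<Omega>) \<le> ennreal (B1 + B2)" for n
    proof -
      have "(\<integral>\<^sup>+c. ennreal (V c) \<partial>distr \<Omega> borel (X n)) = (\<integral>\<^sup>+\<omega>. ennreal (V (X n \<omega>)) \<partial>\<Omega>)"
        by (rule nn_integral_distr) measurable
      thus ?thesis using bound[OF G(1)[of "r n"]] by (simp add: X(3))
    qed
    have "(\<integral>\<^sup>+c. ennreal (V c) \<partial>distr \<Omega> borel Y) = (\<integral>\<^sup>+\<omega>. ennreal (V (Y \<omega>)) \<partial>\<Omega>)"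
      by (rule nn_integral_distr) measurable
    \<comment> \<open>The limit law has just been placed in \<open>\<Sigma>\<close>, so the uniform
      moment bound applies to it as well.\<close>
    hence VY: "(\<integral>\<^sup>+\<omega>. ennreal (V (Y \<omega>)) \<partial>\<Omega>) \<le> ennreal (B1 + B2)"
      using bound[OF Y\<Sigma>] by simp
    have "(\<lambda>n. \<integral>\<omega>. h (X n \<omega>) \<partial>\<Omega>) \<longlonglongrightarrow> (\<integral>\<omega>. h (Y \<omega>) \<partial>\<Omega>)"
      by (rule integral_tendsto_dominated_growth[OF X(1,2,4,5) h growth' Vm V0 VX VY])
    moreover have "(\<integral>\<omega>. h (X n \<omega>) \<partial>\<Omega>) = (f \<circ> r) n" for n
      using integral_distr[OF X(2) hm, of n] by (simp add: X(3) G(2))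
    moreover have "(\<integral>\<omega>. h (Y \<omega>) \<partial>\<Omega>) = (\<integral>s. h s \<partial>distr \<Omega> borel Y)"
      by (rule integral_distr[symmetric]) measurable
    ultimately have "(f \<circ> r) \<longlonglongrightarrow> (\<integral>s. h s \<partial>distr \<Omega> borel Y)" by (simp add: o_def)
    moreover have "(\<integral>s. h s \<partial>distr \<Omega> borel Y) \<in> ?S"
      using Y\<Sigma> unfolding integral_values_def by blast
    ultimately show "\<exists>l\<in>?S. \<exists>r. strict_mono r \<and> (f \<circ> r) \<longlonglongrightarrow> l" using r by blast
  qed
  \<comment> \<open>A convex set of reals is connected, and a compact connected one is an interval.
    Nonemptiness is then what makes both endpoints values of the integral.\<close>
  ultimately obtain a b where S: "?S = {a..b}"
    using connected_compact_interval_1 convex_connected by blast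
  have "?S \<noteq> {}" using nonempty by (auto simp: integral_values_def)
  hence "a \<in> ?S" "b \<in> ?S" unfolding S by auto
  then obtain \<gamma>1 \<gamma>2 where g: "\<gamma>1 \<in> \<Sigma>" "a = (\<integral>s. h s \<partial>\<gamma>1)" "\<gamma>2 \<in> \<Sigma>" "b = (\<integral>s. h s \<partial>\<gamma>2)"
    by (auto simp: integral_values_def)
  have "a \<le> (\<integral>s. h s \<partial>\<gamma>) \<and> (\<integral>s. h s \<partial>\<gamma>) \<le> b" if "\<gamma> \<in> \<Sigma>" for \<gamma>
  proof -
    have "(\<integral>s. h s \<partial>\<gamma>) \<in> ?S" using that by (auto simp: integral_values_def)
    thus ?thesis unfolding S by simp
  qed
  with S int g show ?thesis by blast
qed

section \<open>Gluing two laws along a common marginal\<close>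

text \<open>The label of a point is the index of the first member of a dense sequence within e / 2
  of it; two points sharing that member are closer than e.\<close>

lemma countable_partition_small_diameter:
  fixes e :: real
  assumes "e > 0"
  obtains k :: "'x::{second_countable_topology,metric_space} \<Rightarrow> nat"
  where "k \<in> borel \<rightarrow>\<^sub>M count_space UNIV" "\<And>x y. k x = k y \<Longrightarrow> dist x y < e"
proof -
  obtain D :: "'x set" where D: "countable D" "\<And>X. open X \<Longrightarrow> X \<noteq> {} \<Longrightarrow> \<exists>d\<in>D. d \<in> X"
    by (rule countable_dense_setE) blast
  have "D \<noteq> {}" using D(2)[of UNIV] by auto
  define c where "c = from_nat_into D"
  have c: "\<exists>i. dist x (c i) < e / 2" for x
  proof -
    obtain y where "y \<in> D" "y \<in> ball x (e / 2)" using D(2)[of "ball x (e / 2)"] assms by auto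
    thus ?thesis using from_nat_into_surj[OF D(1)] by (auto simp: c_def)
  qed
  define k where "k x = (LEAST i. dist x (c i) < e / 2)" for x
  have k: "dist x (c (k x)) < e / 2" for x unfolding k_def by (rule LeastI_ex[OF c])
  show ?thesis
  proof (rule that)
    show "k \<in> borel \<rightarrow>\<^sub>M count_space UNIV" unfolding k_def by measurable
    show "dist x y < e" if "k x = k y" for x y
      using k[of x] k[of y] that by (auto intro: dist_triangle_half_l)
  qed
qed

text \<open>Given labels \<open>u\<close>, \<open>v\<close> with equal laws, this density makes the coordinates conditionally
  independent given that their labels agree. Labels of probability zero give the junk value
  \<open>inverse 0 = \<infinity>\<close>, on a null set.\<close>

definition matching_density :: "'a measure \<Rightarrow> ('a \<Rightarrow> nat) \<Rightarrow> ('b \<Rightarrow> nat) \<Rightarrow> 'a \<times> 'b \<Rightarrow> ennreal" where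
  "matching_density M u v z =
    (if u (fst z) = v (snd z) then inverse (emeasure M {a \<in> space M. u a = u (fst z)}) else 0)"

context
  fixes M :: "'a measure" and N :: "'b measure" and u :: "'a \<Rightarrow> nat" and v :: "'b \<Rightarrow> nat"
  assumes MN: "prob_space M" "prob_space N"
    and uv[measurable]: "u \<in> M \<rightarrow>\<^sub>M count_space UNIV" "v \<in> N \<rightarrow>\<^sub>M count_space UNIV"
    and eq: "\<And>i. emeasure M {a \<in> space M. u a = i} = emeasure N {b \<in> space N. v b = i}"
begin

interpretation M: prob_space M by (rule MN)
interpretation N: prob_space N by (rule MN)
interpretation pair_sigma_finite M N ..

lemma matching_density_measurable [measurable]:
  "matching_density M u v \<in> borel_measurable (M \<Otimes>\<^sub>M N)"
proof -
  \<comment> \<open>Equality of labels is spelled out as a countable union over the common value,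
    which exhibits it as measurable.\<close>
  have "Measurable.pred (M \<Otimes>\<^sub>M N) (\<lambda>z. \<exists>i. v (snd z) = i \<and> u (fst z) = i)" by measurable
  hence [measurable]: "Measurable.pred (M \<Otimes>\<^sub>M N) (\<lambda>z. u (fst z) = v (snd z))" by simp
  have [measurable]: "(\<lambda>z. inverse (emeasure M {a \<in> space M. u a = u (fst z)})) \<in> borel_measurable (M \<Otimes>\<^sub>M N)"
    by (rule measurable_compose[where g = "\<lambda>i. inverse (emeasure M {a \<in> space M. u a = i})",
          OF measurable_compose[OF measurable_fst uv(1)]]) simp
  show ?thesis unfolding matching_density_def by measurable
qed

text \<open>There are only countably many labels, so all those of mass zero can be discarded at
  once.\<close>

lemma label_mass_pos_AE:
  "AE a in M. emeasure M {a' \<in> space M. u a' = u a} \<noteq> 0"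
proof -
  have "AE a in M. emeasure M {a' \<in> space M. u a' = i} = 0 \<longrightarrow> u a \<noteq> i" for i
  proof (cases "emeasure M {a' \<in> space M. u a' = i} = 0")
    case True
    have "AE a in M. u a \<noteq> i"
      by (rule AE_I[of _ _ "{a' \<in> space M. u a' = i}"]) (use True in auto)
    thus ?thesis by simp
  qed simp
  hence "AE a in M. \<forall>i. emeasure M {a' \<in> space M. u a' = i} = 0 \<longrightarrow> u a \<noteq> i"
    by (simp add: AE_all_countable)
  thus ?thesis by eventually_elim auto
qed

lemma inverse_label_mass_mult:
  assumes "emeasure M {a \<in> space M. u a = i} \<noteq> 0"
  shows "inverse (emeasure M {a \<in> space M. u a = i}) * emeasure M {a \<in> space M. u a = i} = 1"
proof -
  have "emeasure M {a \<in> space M. u a = i} < top" by (simp add: M.emeasure_eq_measure)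
  with assms have "emeasure M {a \<in> space M. u a = i} / emeasure M {a \<in> space M. u a = i} = 1"
    by (rule ennreal_divide_self)
  thus ?thesis by (simp add: divide_ennreal_def mult.commute)
qed

text \<open>For almost every \<open>a\<close> the density is 1/m on the points of \<open>N\<close>
  that carry the label of \<open>a\<close>, and by equality of the label laws these have mass
  exactly m.\<close>

lemma nn_integral_matching_fst:
  assumes [measurable]: "f \<in> borel_measurable M"
  shows "(\<integral>\<^sup>+z. matching_density M u v z * f (fst z) \<partial>(M \<Otimes>\<^sub>M N)) = (\<integral>\<^sup>+a. f a \<partial>M)"
proof -
  have "(\<integral>\<^sup>+z. matching_density M u v z * f (fst z) \<partial>(M \<Otimes>\<^sub>M N))
      = (\<integral>\<^sup>+a. \<integral>\<^sup>+b. matching_density M u v (a, b) * f a \<partial>N \<partial>M)"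
    by (subst N.nn_integral_fst[symmetric]) auto
  also have "\<dots> = (\<integral>\<^sup>+a. f a \<partial>M)"
  proof (rule nn_integral_cong_AE)
    show "AE a in M. (\<integral>\<^sup>+b. matching_density M u v (a, b) * f a \<partial>N) = f a"
      using label_mass_pos_AE
    proof eventually_elim
      case (elim a)
      let ?m = "emeasure M {a' \<in> space M. u a' = u a}"
      have "(\<integral>\<^sup>+b. matching_density M u v (a, b) * f a \<partial>N)
          = (\<integral>\<^sup>+b. (inverse ?m * f a) * indicator {b \<in> space N. v b = u a} b \<partial>N)"
        by (intro nn_integral_cong) (auto simp: matching_density_def)
      also have "\<dots> = (inverse ?m * f a) * ?m"
        by (subst nn_integral_cmult_indicator) (auto simp: eq)
      also have "\<dots> = (inverse ?m * ?m) * f a" by (simp only: mult_ac)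
      also have "\<dots> = f a" by (simp only: inverse_label_mass_mult[OF elim] mult_1)
      finally show ?case .
    qed
  qed
  finally show ?thesis .
qed

text \<open>The inner integral now runs over \<open>M\<close>, whose own label mass normalises the
  density; equality of the label laws is used to see that labels null for \<open>M\<close> are null
  for \<open>N\<close>.\<close>

lemma nn_integral_matching_snd:
  assumes [measurable]: "f \<in> borel_measurable N"
  shows "(\<integral>\<^sup>+z. matching_density M u v z * f (snd z) \<partial>(M \<Otimes>\<^sub>M N)) = (\<integral>\<^sup>+b. f b \<partial>N)"
proof -
  have "(\<integral>\<^sup>+z. matching_density M u v z * f (snd z) \<partial>(M \<Otimes>\<^sub>M N))
      = (\<integral>\<^sup>+b. \<integral>\<^sup>+a. matching_density M u v (a, b) * f b \<partial>M \<partial>N)"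
    by (subst nn_integral_snd[symmetric]) auto
  also have "\<dots> = (\<integral>\<^sup>+b. f b \<partial>N)"
  proof (rule nn_integral_cong_AE)
    have "AE b in N. \<forall>i. emeasure M {a \<in> space M. u a = i} = 0 \<longrightarrow> v b \<noteq> i"
      unfolding AE_all_countable
    proof
      fix i
      show "AE b in N. emeasure M {a \<in> space M. u a = i} = 0 \<longrightarrow> v b \<noteq> i"
      proof (cases "emeasure M {a \<in> space M. u a = i} = 0")
        case True
        have "AE b in N. v b \<noteq> i"
          by (rule AE_I[of _ _ "{b \<in> space N. v b = i}"]) (use True eq[of i] in auto)
        thus ?thesis by simp
      qed simp
    qed
    thus "AE b in N. (\<integral>\<^sup>+a. matching_density M u v (a, b) * f b \<partial>M) = f b"
    proof eventually_elim
      case (elim b)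
      let ?m = "emeasure M {a \<in> space M. u a = v b}"
      have pos: "?m \<noteq> 0" using elim by blast
      have "(\<integral>\<^sup>+a. matching_density M u v (a, b) * f b \<partial>M)
          = (\<integral>\<^sup>+a. (inverse ?m * f b) * indicator {a \<in> space M. u a = v b} a \<partial>M)"
        by (intro nn_integral_cong) (auto simp: matching_density_def)
      also have "\<dots> = (inverse ?m * f b) * ?m"
        by (subst nn_integral_cmult_indicator) auto
      also have "\<dots> = (inverse ?m * ?m) * f b" by (simp only: mult_ac)
      also have "\<dots> = f b" by (simp only: inverse_label_mass_mult[OF pos] mult_1)
      finally show ?case .
    qed
  qed
  finally show ?thesis .
qed

lemma distr_matching_fst: "distr (density (M \<Otimes>\<^sub>M N) (matching_density M u v)) M fst = M"
proof (rule measure_eqI)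
  fix A assume "A \<in> sets (distr (density (M \<Otimes>\<^sub>M N) (matching_density M u v)) M fst)"
  hence [measurable]: "A \<in> sets M" by simp
  have "emeasure (distr (density (M \<Otimes>\<^sub>M N) (matching_density M u v)) M fst) A
      = (\<integral>\<^sup>+a. indicator A a \<partial>distr (density (M \<Otimes>\<^sub>M N) (matching_density M u v)) M fst)" by simp
  also have "\<dots> = (\<integral>\<^sup>+z. indicator A (fst z) \<partial>density (M \<Otimes>\<^sub>M N) (matching_density M u v))"
    by (rule nn_integral_distr) measurable
  also have "\<dots> = (\<integral>\<^sup>+z. matching_density M u v z * indicator A (fst z) \<partial>(M \<Otimes>\<^sub>M N))"
    by (rule nn_integral_density) measurable
  also have "\<dots> = emeasure M A" by (subst nn_integral_matching_fst) auto
  finally show "emeasure (distr (density (M \<Otimes>\<^sub>M N) (matching_density M u v)) M fst) A = emeasure M A" .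
qed simp

lemma distr_matching_snd: "distr (density (M \<Otimes>\<^sub>M N) (matching_density M u v)) N snd = N"
proof (rule measure_eqI)
  fix A assume "A \<in> sets (distr (density (M \<Otimes>\<^sub>M N) (matching_density M u v)) N snd)"
  hence [measurable]: "A \<in> sets N" by simp
  have "emeasure (distr (density (M \<Otimes>\<^sub>M N) (matching_density M u v)) N snd) A
      = (\<integral>\<^sup>+a. indicator A a \<partial>distr (density (M \<Otimes>\<^sub>M N) (matching_density M u v)) N snd)" by simp
  also have "\<dots> = (\<integral>\<^sup>+z. indicator A (snd z) \<partial>density (M \<Otimes>\<^sub>M N) (matching_density M u v))"
    by (rule nn_integral_distr) measurable
  also have "\<dots> = (\<integral>\<^sup>+z. matching_density M u v z * indicator A (snd z) \<partial>(M \<Otimes>\<^sub>M N))"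
    by (rule nn_integral_density) measurable
  also have "\<dots> = emeasure N A" by (subst nn_integral_matching_snd) auto
  finally show "emeasure (distr (density (M \<Otimes>\<^sub>M N) (matching_density M u v)) N snd) A = emeasure N A" .
qed simp

lemma matching_labels_AE:
  "AE z in density (M \<Otimes>\<^sub>M N) (matching_density M u v). u (fst z) = v (snd z)"
  by (subst AE_density) (auto simp: matching_density_def)

text \<open>Total mass one is read off from the first marginal.\<close>

lemma prob_space_matching: "prob_space (density (M \<Otimes>\<^sub>M N) (matching_density M u v))"
proof (rule prob_space_distrD)
  show "fst \<in> density (M \<Otimes>\<^sub>M N) (matching_density M u v) \<rightarrow>\<^sub>M M" by simp
  show "prob_space (distr (density (M \<Otimes>\<^sub>M N) (matching_density M u v)) M fst)"
    by (simp add: distr_matching_fst MN)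
qed

end

text \<open>Instead of disintegrating along the shared coordinate, the two measures are coupled so that
  the shared coordinates agree up to small cells; a limit of such couplings has both marginals and
  is concentrated where the coordinates coincide.\<close>

lemma gluing:
  fixes M :: "('y1::{second_countable_topology,metric_space} \<times> 'x::{second_countable_topology,metric_space}) measure"
    and N :: "('y2::{second_countable_topology,metric_space} \<times> 'x) measure"
  assumes MN: "M \<in> borel_probs" "N \<in> borel_probs"
    and eq: "distr M borel snd = distr N borel snd"
    and V1: "continuous_on UNIV V1" "\<And>r. compact {z. V1 z \<le> r}" "\<And>z. 0 \<le> V1 z" "(\<integral>\<^sup>+z. ennreal (V1 z) \<partial>M) < \<infinity>"
    and V2: "continuous_on UNIV V2" "\<And>r. compact {z. V2 z \<le> r}" "\<And>z. 0 \<le> V2 z" "(\<integral>\<^sup>+z. ennreal (V2 z) \<partial>N) < \<infinity>"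
  obtains \<gamma> :: "('y1 \<times> 'y2 \<times> 'x) measure" where "\<gamma> \<in> borel_probs"
    "distr \<gamma> borel (\<lambda>(y1, y2, x). (y1, x)) = M" "distr \<gamma> borel (\<lambda>(y1, y2, x). (y2, x)) = N"
proof -
  have sM[measurable_cong]: "sets M = sets borel" and sN[measurable_cong]: "sets N = sets borel"
    and pM: "prob_space M" and pN: "prob_space N" using MN by (auto simp: borel_probs_iff)
  have spM: "space M = UNIV" and spN: "space N = UNIV"
    using sets_eq_imp_space_eq[OF sM] sets_eq_imp_space_eq[OF sN] by simp_all
  interpret M: prob_space M by (rule pM)
  interpret N: prob_space N by (rule pN)
  note [measurable] = borel_measurable_continuous_onI[OF V1(1)] borel_measurable_continuous_onI[OF V2(1)]
  have "\<exists>k :: 'x \<Rightarrow> nat. k \<in> borel \<rightarrow>\<^sub>M count_space UNIV \<and> (\<forall>x y. k x = k y \<longrightarrow> dist x y < inverse (Suc n))" for n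
    by (rule countable_partition_small_diameter[of "inverse (Suc n)"]) auto
  then obtain k :: "nat \<Rightarrow> 'x \<Rightarrow> nat" where k[measurable]: "\<And>n. k n \<in> borel \<rightarrow>\<^sub>M count_space UNIV"
    and kd: "\<And>n x y. k n x = k n y \<Longrightarrow> dist x y < inverse (Suc n)" by metis
  \<comment> \<open>Both labels name the cell of the shared coordinate, so their laws agree because
    the marginals on that coordinate do.\<close>
  define u where "u n z = k n (snd z)" for n and z :: "'y1 \<times> 'x"
  define v where "v n z = k n (snd z)" for n and z :: "'y2 \<times> 'x"
  have um: "u n \<in> M \<rightarrow>\<^sub>M count_space UNIV" and vm: "v n \<in> N \<rightarrow>\<^sub>M count_space UNIV" for n
    unfolding u_def v_def by measurable
  have uv: "emeasure M {a \<in> space M. u n a = i} = emeasure N {b \<in> space N. v n b = i}" for n i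
  proof -
    have [measurable]: "{x. k n x = i} \<in> sets borel" by measurable
    have "emeasure M {a \<in> space M. u n a = i} = emeasure (distr M borel snd) {x. k n x = i}"
      by (subst emeasure_distr) (auto simp: u_def spM intro!: arg_cong2[where f = emeasure])
    also have "\<dots> = emeasure N {b \<in> space N. v n b = i}"
      unfolding eq by (subst emeasure_distr) (auto simp: v_def spN intro!: arg_cong2[where f = emeasure])
    finally show ?thesis .
  qed
  note facts = pM pN um vm uv
  define P where "P n = density (M \<Otimes>\<^sub>M N) (matching_density M (u n) (v n))" for n
  have sP[measurable_cong]: "sets (P n) = sets borel" for n
    unfolding P_def sets_density sets_pair_measure_cong[OF sM sN] borel_prod ..
  have Pb: "P n \<in> borel_probs" for n
    unfolding borel_probs_iff using sP prob_space_matching[OF facts, of n] by (simp add: P_def)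
  have P1: "distr (P n) borel fst = M" for n
    using distr_matching_fst[OF facts, of n] distr_cong[OF refl sM, of "P n" fst fst] by (simp add: P_def)
  have P2: "distr (P n) borel snd = N" for n
    using distr_matching_snd[OF facts, of n] distr_cong[OF refl sN, of "P n" snd snd] by (simp add: P_def)
  have Pd: "AE z in P n. dist (snd (fst z)) (snd (snd z)) < inverse (Suc n)" for n
    using matching_labels_AE[OF facts, of n] unfolding P_def u_def v_def
    by eventually_elim (rule kd)
  define V where "V z = V1 (fst z) + V2 (snd z)" for z
  have Vc: "continuous_on UNIV V"
    unfolding V_def using V1(1) V2(1)
    by (intro continuous_on_add continuous_on_compose2[OF V1(1)] continuous_on_compose2[OF V2(1)] continuous_intros) auto
  have V0: "0 \<le> V z" for z using V1(3) V2(3) by (simp add: V_def)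
  have Vk: "compact {z. V z \<le> r}" for r
  proof (rule compact_sublevel_subset[OF Vc])
    show "compact ({z. V1 z \<le> r} \<times> {z. V2 z \<le> r})" by (intro compact_Times V1 V2)
    show "{z. V z \<le> r} \<subseteq> {z. V1 z \<le> r} \<times> {z. V2 z \<le> r}"
    proof
      fix z assume "z \<in> {z. V z \<le> r}"
      thus "z \<in> {z. V1 z \<le> r} \<times> {z. V2 z \<le> r}"
        using V1(3)[of "fst z"] V2(3)[of "snd z"] by (simp add: V_def mem_Times_iff)
    qed
  qed
  \<comment> \<open>All \<open>P n\<close> have the marginals \<open>M\<close> and \<open>N\<close>,
    so their \<open>V\<close>-moments are one and the same finite number.\<close>
  define A where "A = (\<integral>\<^sup>+z. ennreal (V1 z) \<partial>M) + (\<integral>\<^sup>+z. ennreal (V2 z) \<partial>N)"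
  have "A < \<infinity>" using V1(4) V2(4) by (simp add: A_def)
  have "(\<integral>\<^sup>+z. ennreal (V z) \<partial>P n) = A" for n
  proof -
    have "(\<integral>\<^sup>+z. ennreal (V z) \<partial>P n) = (\<integral>\<^sup>+z. ennreal (V1 (fst z)) + ennreal (V2 (snd z)) \<partial>P n)"
      using V1(3) V2(3) by (simp add: V_def)
    also have "\<dots> = (\<integral>\<^sup>+z. ennreal (V1 (fst z)) \<partial>P n) + (\<integral>\<^sup>+z. ennreal (V2 (snd z)) \<partial>P n)"
      by (rule nn_integral_add) measurable
    also have "(\<integral>\<^sup>+z. ennreal (V1 (fst z)) \<partial>P n) = (\<integral>\<^sup>+z. ennreal (V1 z) \<partial>distr (P n) borel fst)"
      by (rule nn_integral_distr[symmetric]) measurable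
    also have "(\<integral>\<^sup>+z. ennreal (V2 (snd z)) \<partial>P n) = (\<integral>\<^sup>+z. ennreal (V2 z) \<partial>distr (P n) borel snd)"
      by (rule nn_integral_distr[symmetric]) measurable
    finally show ?thesis by (simp add: P1 P2 A_def)
  qed
  hence bound: "(\<integral>\<^sup>+z. ennreal (V z) \<partial>P n) \<le> ennreal (enn2real A)" for n
    using \<open>A < \<infinity>\<close> by (simp add: ennreal_enn2real)
  obtain r and \<Omega> :: "real measure" and Z W where r: "strict_mono r" and Z: "prob_space \<Omega>"
    "\<forall>n. Z n \<in> borel_measurable \<Omega>" "\<forall>n. distr \<Omega> borel (Z n) = P (r n)"
    "W \<in> borel_measurable \<Omega>" "AE \<omega> in \<Omega>. (\<lambda>n. Z n \<omega>) \<longlonglongrightarrow> W \<omega>"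
    using prokhorov_skorohod[where P = P, OF Vc Vk V0 Pb bound] .
  note Z = Z[rule_format]
  interpret \<Omega>: prob_space \<Omega> by (rule Z)
  note [measurable] = Z(2,4)
  have W1: "distr \<Omega> borel (\<lambda>\<omega>. fst (W \<omega>)) = M"
  proof -
    have "distr \<Omega> borel (\<lambda>\<omega>. fst (W \<omega>)) = distr M borel (\<lambda>x. x)"
    proof (rule limit_law_unique[OF Z(1) _ _ _ pM, where X' = "\<lambda>_ x. x"])
      show "AE \<omega> in \<Omega>. (\<lambda>n. fst (Z n \<omega>)) \<longlonglongrightarrow> fst (W \<omega>)"
        using Z(5) by eventually_elim (rule tendsto_fst)
      show "distr \<Omega> borel (\<lambda>\<omega>. fst (Z n \<omega>)) = distr M borel (\<lambda>x. x)" for n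
        using distr_distr[OF fst_borel_measurable Z(2), of n] by (simp add: Z(3) P1 o_def distr_id2 sM)
    qed auto
    thus ?thesis by (simp add: distr_id2 sM)
  qed
  have W2: "distr \<Omega> borel (\<lambda>\<omega>. snd (W \<omega>)) = N"
  proof -
    have "distr \<Omega> borel (\<lambda>\<omega>. snd (W \<omega>)) = distr N borel (\<lambda>x. x)"
    proof (rule limit_law_unique[OF Z(1) _ _ _ pN, where X' = "\<lambda>_ x. x"])
      show "AE \<omega> in \<Omega>. (\<lambda>n. snd (Z n \<omega>)) \<longlonglongrightarrow> snd (W \<omega>)"
        using Z(5) by eventually_elim (rule tendsto_snd)
      show "distr \<Omega> borel (\<lambda>\<omega>. snd (Z n \<omega>)) = distr N borel (\<lambda>x. x)" for n
        using distr_distr[OF snd_borel_measurable Z(2), of n] by (simp add: Z(3) P2 o_def distr_id2 sN)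
    qed auto
    thus ?thesis by (simp add: distr_id2 sN)
  qed
  have "AE \<omega> in \<Omega>. dist (snd (fst (Z n \<omega>))) (snd (snd (Z n \<omega>))) < inverse (Suc (r n))" for n
  proof -
    have "AE z in distr \<Omega> borel (Z n). dist (snd (fst z)) (snd (snd z)) < inverse (Suc (r n))"
      unfolding Z(3) by (rule Pd)
    thus ?thesis by (rule AE_distrD[OF Z(2)])
  qed
  hence "AE \<omega> in \<Omega>. \<forall>n. dist (snd (fst (Z n \<omega>))) (snd (snd (Z n \<omega>))) < inverse (Suc (r n))"
    by (simp add: AE_all_countable)
  \<comment> \<open>The shared coordinates differ by less than 1/(r n + 1) along the sequence, and
    this bound tends to 0.\<close>
  with Z(5) have Wd: "AE \<omega> in \<Omega>. snd (fst (W \<omega>)) = snd (snd (W \<omega>))"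
  proof eventually_elim
    case (elim \<omega>)
    have "(\<lambda>n. dist (snd (fst (Z n \<omega>))) (snd (snd (Z n \<omega>)))) \<longlonglongrightarrow> dist (snd (fst (W \<omega>))) (snd (snd (W \<omega>)))"
      by (intro tendsto_dist tendsto_fst tendsto_snd elim)
    moreover have "(\<lambda>n. inverse (real (Suc (r n)))) \<longlonglongrightarrow> 0"
      using LIMSEQ_subseq_LIMSEQ[OF LIMSEQ_inverse_real_of_nat r] by (simp add: o_def)
    ultimately have "dist (snd (fst (W \<omega>))) (snd (snd (W \<omega>))) \<le> 0"
      by (rule LIMSEQ_le) (use elim(2) in \<open>auto intro: less_imp_le\<close>)
    thus ?case by simp
  qed
  \<comment> \<open>The shared coordinate is taken from the first pair: the first marginal is then
    immediate, and the second one needs the almost sure equality \<open>Wd\<close>.\<close>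
  define T where "T \<omega> = (fst (fst (W \<omega>)), fst (snd (W \<omega>)), snd (fst (W \<omega>)))" for \<omega>
  have Tm[measurable]: "T \<in> borel_measurable \<Omega>"
    unfolding T_def by (intro borel_measurable_Pair measurable_compose[OF _ fst_borel_measurable]
        measurable_compose[OF _ snd_borel_measurable] Z)
  have m1[measurable]: "(\<lambda>(y1, y2, x). (y1, x)) \<in> borel_measurable (borel :: ('y1 \<times> 'y2 \<times> 'x) measure)"
    unfolding case_prod_beta by (intro borel_measurable_continuous_onI continuous_intros)
  have m2[measurable]: "(\<lambda>(y1, y2, x). (y2, x)) \<in> borel_measurable (borel :: ('y1 \<times> 'y2 \<times> 'x) measure)"
    unfolding case_prod_beta by (intro borel_measurable_continuous_onI continuous_intros)
  show ?thesis
  proof (rule that)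
    show "distr \<Omega> borel T \<in> borel_probs" by (auto simp: borel_probs_iff intro!: \<Omega>.prob_space_distr)
    have "distr (distr \<Omega> borel T) borel (\<lambda>(y1, y2, x). (y1, x)) = distr \<Omega> borel (\<lambda>\<omega>. fst (W \<omega>))"
      by (subst distr_distr[OF m1 Tm]) (simp add: o_def T_def)
    thus "distr (distr \<Omega> borel T) borel (\<lambda>(y1, y2, x). (y1, x)) = M" by (simp add: W1)
    have "distr (distr \<Omega> borel T) borel (\<lambda>(y1, y2, x). (y2, x)) = distr \<Omega> borel (\<lambda>\<omega>. (fst (snd (W \<omega>)), snd (fst (W \<omega>))))"
      by (subst distr_distr[OF m2 Tm]) (simp add: o_def T_def)
    also have "\<dots> = distr \<Omega> borel (\<lambda>\<omega>. snd (W \<omega>))"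
    proof (rule distr_cong_AE)
      show "AE \<omega> in \<Omega>. (fst (snd (W \<omega>)), snd (fst (W \<omega>))) = snd (W \<omega>)"
        using Wd by eventually_elim (simp add: prod_eq_iff)
      show "(\<lambda>\<omega>. (fst (snd (W \<omega>)), snd (fst (W \<omega>)))) \<in> borel_measurable \<Omega>"
        by (intro borel_measurable_Pair measurable_compose[OF _ fst_borel_measurable]
          measurable_compose[OF _ snd_borel_measurable] Z)
    qed auto
    finally show "distr (distr \<Omega> borel T) borel (\<lambda>(y1, y2, x). (y2, x)) = N" by (simp add: W2)
  qed
qed

section \<open>The non-overlapping and the overlapping case\<close>

lemma prob_space_distr_pair_snd:
  assumes "prob_space M" "prob_space N"
  shows "distr (M \<Otimes>\<^sub>M N) N snd = N"
proof (rule measure_eqI)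
  interpret M: prob_space M by fact
  interpret N: prob_space N by fact
  fix A assume "A \<in> sets (distr (M \<Otimes>\<^sub>M N) N snd)"
  hence A: "A \<in> sets N" by simp
  have "snd -` A \<inter> space (M \<Otimes>\<^sub>M N) = space M \<times> A"
    using sets.sets_into_space[OF A] by (auto simp: space_pair_measure)
  thus "emeasure (distr (M \<Otimes>\<^sub>M N) N snd) A = emeasure N A"
    using A by (simp add: emeasure_distr N.emeasure_pair_measure_Times M.emeasure_space_1)
qed simp

text \<open>Integrability is part of the conclusion because the Bochner integral defaults to 0; it
  ensures that the values, and with them both endpoints, are genuine finite integrals.\<close>

theorem proposition4p1:
  fixes p1 p2 \<delta>1 \<delta>2 :: real
    and \<mu>1 :: "'s1::polish_space measure" and \<mu>2 :: "'s2::polish_space measure"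
    and g :: "'s1 \<times> 's2 \<Rightarrow> real"
    and d1 :: "'y1::polish_space \<times> 'x::polish_space \<Rightarrow> 'y1 \<times> 'x \<Rightarrow> real"
    and d2 :: "'y2::polish_space \<times> 'x \<Rightarrow> 'y2 \<times> 'x \<Rightarrow> real"
    and \<mu>13 :: "('y1 \<times> 'x) measure" and \<mu>23 :: "('y2 \<times> 'x) measure"
    and f :: "'y1 \<times> 'y2 \<times> 'x \<Rightarrow> real"
  assumes "p1 \<ge> 1" and "p2 \<ge> 1" and "\<delta>1 \<ge> 0" and "\<delta>2 \<ge> 0"
  shows
   "(proper_metric (dist :: 's1 \<Rightarrow> 's1 \<Rightarrow> real) \<and>
     proper_metric (dist :: 's2 \<Rightarrow> 's2 \<Rightarrow> real) \<and>
     \<mu>1 \<in> finite_moment_probs dist p1 \<and>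
     \<mu>2 \<in> finite_moment_probs dist p2 \<and>
     continuous_on UNIV g \<and>
     (\<exists>M s1' s2' p1' p2'. M > 0 \<and> 0 < p1' \<and> p1' < p1 \<and> 0 < p2' \<and> p2' < p2 \<and>
        (\<forall>s1 s2. \<bar>g (s1, s2)\<bar> \<le> M * (1 + dist s1' s1 powr p1' + dist s2' s2 powr p2')))
     \<longrightarrow>
     (let \<Sigma> = Sigma_D (\<lambda>s t. dist s t powr p1) (\<lambda>s t. dist s t powr p2) \<mu>1 \<mu>2 \<delta>1 \<delta>2 in
        (\<forall>\<gamma>\<in>\<Sigma>. integrable \<gamma> g) \<and>
        (\<exists>\<gamma>min\<in>\<Sigma>. \<exists>\<gamma>max\<in>\<Sigma>.
           (\<forall>\<gamma>\<in>\<Sigma>. (\<integral>s. g s \<partial>\<gamma>min) \<le> (\<integral>s. g s \<partial>\<gamma>) \<and> (\<integral>s. g s \<partial>\<gamma>) \<le> (\<integral>s. g s \<partial>\<gamma>max)) \<and>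
           integral_values g \<Sigma> = {(\<integral>s. g s \<partial>\<gamma>min) .. (\<integral>s. g s \<partial>\<gamma>max)})))
    \<and>
    (polish_metric d1 \<and> proper_metric d1 \<and>
     polish_metric d2 \<and> proper_metric d2 \<and>
     \<mu>13 \<in> finite_moment_probs d1 p1 \<and>
     \<mu>23 \<in> finite_moment_probs d2 p2 \<and>
     distr \<mu>13 borel snd = distr \<mu>23 borel snd \<and>
     continuous_on UNIV f \<and>
     (\<exists>M s1' s2' p1' p2'. M > 0 \<and> 0 < p1' \<and> p1' < p1 \<and> 0 < p2' \<and> p2' < p2 \<and>
        (\<forall>y1 y2 x. \<bar>f (y1, y2, x)\<bar>
                    \<le> M * (1 + d1 s1' (y1, x) powr p1' + d2 s2' (y2, x) powr p2')))
     \<longrightarrow>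
     (let \<Sigma> = Sigma_O (\<lambda>s t. d1 s t powr p1) (\<lambda>s t. d2 s t powr p2) \<mu>13 \<mu>23 \<delta>1 \<delta>2 in
        (\<forall>\<gamma>\<in>\<Sigma>. integrable \<gamma> f) \<and>
        (\<exists>\<gamma>min\<in>\<Sigma>. \<exists>\<gamma>max\<in>\<Sigma>.
           (\<forall>\<gamma>\<in>\<Sigma>. (\<integral>s. f s \<partial>\<gamma>min) \<le> (\<integral>s. f s \<partial>\<gamma>) \<and> (\<integral>s. f s \<partial>\<gamma>) \<le> (\<integral>s. f s \<partial>\<gamma>max)) \<and>
           integral_values f \<Sigma> = {(\<integral>s. f s \<partial>\<gamma>min) .. (\<integral>s. f s \<partial>\<gamma>max)})))"
proof (intro conjI impI, goal_cases)
  case 1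
  then obtain M s1' s2' p1' p2' where proper: "proper_metric (dist :: 's1 \<Rightarrow> 's1 \<Rightarrow> real)"
      "proper_metric (dist :: 's2 \<Rightarrow> 's2 \<Rightarrow> real)"
    and \<mu>: "\<mu>1 \<in> finite_moment_probs dist p1" "\<mu>2 \<in> finite_moment_probs dist p2"
    and g: "continuous_on UNIV g"
    and growth: "M > 0" "0 < p1'" "p1' < p1" "0 < p2'" "p2' < p2"
      "\<forall>s1 s2. \<bar>g (s1, s2)\<bar> \<le> M * (1 + dist s1' s1 powr p1' + dist s2' s2 powr p2')"
    by blast
  have d: "proper_cost (dist :: 's1 \<Rightarrow> 's1 \<Rightarrow> real) p1" "proper_cost (dist :: 's2 \<Rightarrow> 's2 \<Rightarrow> real) p2"
    using proper assms(1,2) by (auto intro: proper_cost_dist)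
  interpret d1: proper_cost "dist :: 's1 \<Rightarrow> 's1 \<Rightarrow> real" p1 by (rule d)
  interpret d2: proper_cost "dist :: 's2 \<Rightarrow> 's2 \<Rightarrow> real" p2 by (rule d)
  have \<mu>b: "\<mu>1 \<in> borel_probs" "\<mu>2 \<in> borel_probs" using \<mu> by (auto simp: finite_moment_probs_def)
  hence s: "sets \<mu>1 = sets borel" "sets \<mu>2 = sets borel" and ps: "prob_space \<mu>1" "prob_space \<mu>2"
    by (auto simp: borel_probs_iff)
  \<comment> \<open>The product has exactly the reference measures as marginals, so both transport
    costs are 0, whatever the radii.\<close>
  have "\<mu>1 \<Otimes>\<^sub>M \<mu>2 \<in> Sigma_D (\<lambda>s t. dist s t powr p1) (\<lambda>s t. dist s t powr p2) \<mu>1 \<mu>2 \<delta>1 \<delta>2"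
  proof -
    have "sets (\<mu>1 \<Otimes>\<^sub>M \<mu>2) = sets borel"
      unfolding sets_pair_measure_cong[OF s] borel_prod ..
    moreover have "distr (\<mu>1 \<Otimes>\<^sub>M \<mu>2) borel fst = \<mu>1"
      using prob_space.distr_pair_fst[OF ps(2), of \<mu>1] distr_cong[OF refl s(1), of "\<mu>1 \<Otimes>\<^sub>M \<mu>2" fst fst] by simp
    moreover have "distr (\<mu>1 \<Otimes>\<^sub>M \<mu>2) borel snd = \<mu>2"
      using prob_space_distr_pair_snd[OF ps] distr_cong[OF refl s(2), of "\<mu>1 \<Otimes>\<^sub>M \<mu>2" snd snd] by simp
    moreover have "transport_cost (\<lambda>s t. dist s t powr p1) \<mu>1 \<mu>1 = 0"
      by (rule transport_cost_same[OF \<mu>b(1)]) (auto simp: d1.cost_measurable)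
    moreover have "transport_cost (\<lambda>s t. dist s t powr p2) \<mu>2 \<mu>2 = 0"
      by (rule transport_cost_same[OF \<mu>b(2)]) (auto simp: d2.cost_measurable)
    ultimately show ?thesis
      using prob_space_pair[OF ps] by (simp add: Sigma_D_def borel_probs_iff)
  qed
  hence nonempty: "Sigma_D (\<lambda>s t. dist s t powr p1) (\<lambda>s t. dist s t powr p2) \<mu>1 \<mu>2 \<delta>1 \<delta>2 \<noteq> {}" by blast
  show ?case
    unfolding Let_def Sigma_D_def
  proof (rule integral_values_transport_ball[OF d \<mu> assms(3,4) _ _ _ g growth(1-5)])
    show "continuous_on UNIV (fst :: 's1 \<times> 's2 \<Rightarrow> 's1)" "continuous_on UNIV (snd :: 's1 \<times> 's2 \<Rightarrow> 's2)"
      by (intro continuous_intros)+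
    show "compact {c. fst c \<in> K1 \<and> snd c \<in> K2}" if "compact K1" "compact K2" for K1 :: "'s1 set" and K2 :: "'s2 set"
    proof -
      have "{c. fst c \<in> K1 \<and> snd c \<in> K2} = K1 \<times> K2" by (auto simp: mem_Times_iff)
      thus ?thesis using compact_Times[OF that] by simp
    qed
    show "\<bar>g c\<bar> \<le> M * (1 + dist s1' (fst c) powr p1' + dist s2' (snd c) powr p2')" for c
      using growth(6) by (cases c) simp
  qed (use nonempty in \<open>simp add: Sigma_D_def\<close>)
next
  case 2
  then obtain M s1' s2' p1' p2' where polish: "polish_metric d1" "polish_metric d2"
    and proper: "proper_metric d1" "proper_metric d2"
    and \<mu>: "\<mu>13 \<in> finite_moment_probs d1 p1" "\<mu>23 \<in> finite_moment_probs d2 p2"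
    and eq: "distr \<mu>13 borel snd = distr \<mu>23 borel snd"
    and f: "continuous_on UNIV f"
    and growth: "M > 0" "0 < p1'" "p1' < p1" "0 < p2'" "p2' < p2"
      "\<forall>y1 y2 x. \<bar>f (y1, y2, x)\<bar> \<le> M * (1 + d1 s1' (y1, x) powr p1' + d2 s2' (y2, x) powr p2')"
    by blast
  have d: "proper_cost d1 p1" "proper_cost d2 p2"
    using polish proper assms(1,2) by (auto intro: proper_cost_polish_metric)
  interpret d1: proper_cost d1 p1 by (rule d)
  interpret d2: proper_cost d2 p2 by (rule d)
  have \<mu>b: "\<mu>13 \<in> borel_probs" "\<mu>23 \<in> borel_probs" using \<mu> by (auto simp: finite_moment_probs_def)
  have q: "continuous_on UNIV (\<lambda>(y1, y2, x). (y1, x) :: 'y1 \<times> 'x)" "continuous_on UNIV (\<lambda>(y1, y2, x). (y2, x) :: 'y2 \<times> 'x)"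
    unfolding case_prod_beta by (intro continuous_intros)+
  \<comment> \<open>The costs from a base point serve as the functions with compact sublevel sets;
    the moment hypotheses make their integrals finite.\<close>
  obtain \<gamma> :: "('y1 \<times> 'y2 \<times> 'x) measure" where \<gamma>: "\<gamma> \<in> borel_probs"
    "distr \<gamma> borel (\<lambda>(y1, y2, x). (y1, x)) = \<mu>13" "distr \<gamma> borel (\<lambda>(y1, y2, x). (y2, x)) = \<mu>23"
    by (rule gluing[OF \<mu>b eq d1.continuous_cost_section d1.compact_cost_sublevel powr_ge_zero d1.finite_moment_at[OF \<mu>(1)]
          d2.continuous_cost_section d2.compact_cost_sublevel powr_ge_zero d2.finite_moment_at[OF \<mu>(2)]])
  have "transport_cost d1.cost \<mu>13 \<mu>13 = 0" "transport_cost d2.cost \<mu>23 \<mu>23 = 0"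
    using d1.self d2.self \<mu>b by (auto intro!: transport_cost_same simp: d1.cost_measurable d2.cost_measurable)
  with \<gamma> have nonempty: "Sigma_O d1.cost d2.cost \<mu>13 \<mu>23 \<delta>1 \<delta>2 \<noteq> {}"
    by (auto simp: Sigma_O_def intro!: exI[of _ \<gamma>])
  show ?case
    unfolding Let_def Sigma_O_def
  proof (rule integral_values_transport_ball[OF d \<mu> assms(3,4) q _ f growth(1-5)])
    fix K1 :: "('y1 \<times> 'x) set" and K2 :: "('y2 \<times> 'x) set"
    assume K: "compact K1" "compact K2"
    let ?S = "{c. (case c of (y1, y2, x) \<Rightarrow> (y1, x)) \<in> K1 \<and> (case c of (y1, y2, x) \<Rightarrow> (y2, x)) \<in> K2}"
    have "closed ?S"
      unfolding Collect_conj_eq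
      by (intro closed_Int closed_vimage[OF compact_imp_closed[OF K(1)] q(1), unfolded vimage_def]
          closed_vimage[OF compact_imp_closed[OF K(2)] q(2), unfolded vimage_def])
    \<comment> \<open>A compact box around \<open>?S\<close>. The shared coordinate could be read
      from either set; here it is read from \<open>K1\<close>.\<close>
    moreover have "compact (fst ` K1 \<times> fst ` K2 \<times> snd ` K1)"
      using K by (intro compact_Times compact_continuous_image continuous_intros)
    ultimately have "compact ((fst ` K1 \<times> fst ` K2 \<times> snd ` K1) \<inter> ?S)" by (intro compact_Int_closed)
    moreover have "?S \<subseteq> fst ` K1 \<times> fst ` K2 \<times> snd ` K1" by force
    ultimately show "compact ?S" by (simp only: Int_absorb1)
  next
    show "\<bar>f c\<bar> \<le> M * (1 + d1 s1' (case c of (y1, y2, x) \<Rightarrow> (y1, x)) powr p1' + d2 s2' (case c of (y1, y2, x) \<Rightarrow> (y2, x)) powr p2')" for c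
      using growth(6) by (cases c) simp
  qed (use nonempty in \<open>simp add: Sigma_O_def\<close>)
qed

end
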